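(* Let $L$ be a positive line bundle over a connected compact Kähler manifold $X$, let $L'$ be its dual bundle, and let $d>0$. Let $\mathcal{H}_d^+$ denote the family of all functions $\chi\in PSH(L')$ which are nonnegative, not identically $0$, and absolutely homogeneous of order $d$ in each fiber. Then there is a one-to-one correspondence between $\mathcal{H}_d^+$ and the class of positive metrics on $L$.
   Context: Line bundles are holomorphic. $PSH(L')$ is the class of plurisubharmonic functions on the total space of $L'$. A function $\chi$ on $L'$ is absolutely homogeneous of order $d$ in each fiber if $\chi(\lambda\xi)=|\lambda|^d\chi(\xi)$ for all $\lambda\in\mathbb{C}$ and $\xi\in L'$. A (singular) metric on $L$ is given by a collection $h=\{h_j\}$ of real-valued functions, $h_j$ being defined on the set $U_j$ of a trivializing cover $\{U_j\}$ of $X$ for $L$, such that $h_j=h_i+\log|g_{ij}|$ on $U_i\cap U_j$, where $g_{ij}$ are the transition functions for $L$. The metric is called positive if all $h_j$ are plurisubharmonic (positivity of a metric is thus meant in the weak sense). The line bundle $L$ is positive if it admits a smooth metric $\{\phi_j\}$ such that the form $\omega$ given by $\omega=dd^c\phi_j$ on each $U_j$ is a Kähler form. *)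

theory Defs
  imports "HOL-Analysis.Analysis"
begin

section \<open>Functions on open subsets of complex n-space\<close>

definition holo_fun_on :: "(complex^'n) set \<Rightarrow> (complex^'n \<Rightarrow> complex) \<Rightarrow> bool" where
  "holo_fun_on S f \<longleftrightarrow>
     (\<forall>z\<in>S. \<exists>D. (f has_derivative D) (at z) \<and> (\<forall>c v. D (c *s v) = c * D v))"

definition holo_map_on :: "(complex^'n) set \<Rightarrow> (complex^'n \<Rightarrow> complex^'m) \<Rightarrow> bool" where
  "holo_map_on S f \<longleftrightarrow> (\<forall>k. holo_fun_on S (\<lambda>z. f z $ k))"

primrec Ck_on :: "nat \<Rightarrow> 'v::euclidean_space set \<Rightarrow> ('v \<Rightarrow> real) \<Rightarrow> bool" where
  "Ck_on 0 S f \<longleftrightarrow> continuous_on S f"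
| "Ck_on (Suc k) S f \<longleftrightarrow>
     (\<forall>z\<in>S. f differentiable (at z)) \<and> (\<forall>v. Ck_on k S (\<lambda>z. frechet_derivative f (at z) v))"

definition smooth_on :: "'v::euclidean_space set \<Rightarrow> ('v \<Rightarrow> real) \<Rightarrow> bool" where
  "smooth_on S f \<longleftrightarrow> (\<forall>k. Ck_on k S f)"

text \<open>Lebesgue integral with values in the extended reals, for functions whose positive or
  negative part has finite integral. Upper semicontinuous functions without the value
  \<open>\<infinity>\<close> on a circle are bounded above, so the mean below is always meaningful for them.\<close>

definition ereal_integral :: "'x measure \<Rightarrow> ('x \<Rightarrow> ereal) \<Rightarrow> ereal" where
  "ereal_integral M f =
     enn2ereal (\<integral>\<^sup>+x. e2ennreal (f x) \<partial>M) - enn2ereal (\<integral>\<^sup>+x. e2ennreal (- f x) \<partial>M)"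

definition circle_mean :: "(complex^'n \<Rightarrow> ereal) \<Rightarrow> complex^'n \<Rightarrow> complex^'n \<Rightarrow> ereal" where
  "circle_mean u a w = ereal_integral (uniform_measure lborel {0..2*pi}) (\<lambda>t. u (a + cis t *s w))"

text \<open>Plurisubharmonic functions on an open set take values in \<open>[-\<infinity>, \<infinity>)\<close>; the function
  identically \<open>-\<infinity>\<close> on a connected component is excluded.\<close>

definition psh_on :: "(complex^'n) set \<Rightarrow> (complex^'n \<Rightarrow> ereal) \<Rightarrow> bool" where
  "psh_on S u \<longleftrightarrow>
     (\<forall>z\<in>S. u z < \<infinity>) \<and>
     (\<forall>c. openin (top_of_set S) {z\<in>S. u z < c}) \<and>
     (\<forall>a w. (\<forall>\<zeta>\<in>cball 0 1. a + \<zeta> *s w \<in> S) \<longrightarrow> u a \<le> circle_mean u a w) \<and>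
     (\<forall>C\<in>components S. \<exists>z\<in>C. u z \<noteq> -\<infinity>)"

section \<open>Complex manifolds\<close>

text \<open>A chart is a pair of its domain and a coordinate map; only the values of the coordinate map
  on the domain matter.\<close>

type_synonym ('a, 'n) chart = "'a set \<times> ('a \<Rightarrow> complex^'n)"

definition chart_inv :: "('a, 'n::finite) chart \<Rightarrow> complex^'n \<Rightarrow> 'a" where
  "chart_inv c = inv_into (fst c) (snd c)"

definition complex_manifold :: "'a topology \<Rightarrow> ('a, 'n::finite) chart set \<Rightarrow> bool" where
  "complex_manifold X A \<longleftrightarrow>
     Hausdorff_space X \<and> second_countable X \<and>
     (\<Union>c\<in>A. fst c) = topspace X \<and>
     (\<forall>c\<in>A. openin X (fst c) \<and> open (snd c ` fst c) \<and>
        homeomorphic_map (subtopology X (fst c)) (top_of_set (snd c ` fst c)) (snd c)) \<and>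
     (\<forall>c\<in>A. \<forall>c'\<in>A. holo_map_on (snd c ` (fst c \<inter> fst c')) (snd c' \<circ> chart_inv c))"

text \<open>The following notions for functions on an open subset \<open>U\<close> of a manifold are local and
  invariant under biholomorphic maps, so they are expressed in the charts of a given atlas.\<close>

definition mfd_holo_on :: "('a, 'n::finite) chart set \<Rightarrow> 'a set \<Rightarrow> ('a \<Rightarrow> complex) \<Rightarrow> bool" where
  "mfd_holo_on A U f \<longleftrightarrow> (\<forall>c\<in>A. holo_fun_on (snd c ` (fst c \<inter> U)) (f \<circ> chart_inv c))"

definition mfd_smooth_on :: "('a, 'n::finite) chart set \<Rightarrow> 'a set \<Rightarrow> ('a \<Rightarrow> real) \<Rightarrow> bool" where
  "mfd_smooth_on A U f \<longleftrightarrow> (\<forall>c\<in>A. smooth_on (snd c ` (fst c \<inter> U)) (f \<circ> chart_inv c))"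

definition mfd_psh_on :: "('a, 'n::finite) chart set \<Rightarrow> 'a set \<Rightarrow> ('a \<Rightarrow> ereal) \<Rightarrow> bool" where
  "mfd_psh_on A U u \<longleftrightarrow> (\<forall>c\<in>A. psh_on (snd c ` (fst c \<inter> U)) (u \<circ> chart_inv c))"

section \<open>Differential forms and Kaehler manifolds\<close>

text \<open>\<open>d\<^sup>c\<phi>(v) = - d\<phi>(iv)\<close>, that is \<open>d\<^sup>c = i(\<partial>bar - \<partial>)\<close> and \<open>dd\<^sup>c = 2i\<partial>\<partial>bar\<close>. Other
  normalizations differ by a positive constant, which is irrelevant for positivity of forms.\<close>

definition dc :: "(complex^'n \<Rightarrow> real) \<Rightarrow> complex^'n \<Rightarrow> complex^'n \<Rightarrow> real" where
  "dc \<phi> z v = - frechet_derivative \<phi> (at z) (\<i> *s v)"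

definition ext_deriv1 ::
    "(complex^'n \<Rightarrow> complex^'n \<Rightarrow> real) \<Rightarrow> complex^'n \<Rightarrow> complex^'n \<Rightarrow> complex^'n \<Rightarrow> real" where
  "ext_deriv1 \<alpha> z u v =
     frechet_derivative (\<lambda>y. \<alpha> y v) (at z) u - frechet_derivative (\<lambda>y. \<alpha> y u) (at z) v"

definition ext_deriv2 ::
    "(complex^'n \<Rightarrow> complex^'n \<Rightarrow> complex^'n \<Rightarrow> real) \<Rightarrow>
     complex^'n \<Rightarrow> complex^'n \<Rightarrow> complex^'n \<Rightarrow> complex^'n \<Rightarrow> real" where
  "ext_deriv2 \<omega> z u v w =
     frechet_derivative (\<lambda>y. \<omega> y v w) (at z) u
     - frechet_derivative (\<lambda>y. \<omega> y u w) (at z) v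
     + frechet_derivative (\<lambda>y. \<omega> y u v) (at z) w"

definition ddc :: "(complex^'n \<Rightarrow> real) \<Rightarrow> complex^'n \<Rightarrow> complex^'n \<Rightarrow> complex^'n \<Rightarrow> real" where
  "ddc \<phi> = ext_deriv1 (dc \<phi>)"

text \<open>A 2-form on a manifold is given by its coordinate expression in every chart; these are
  related by pullback along the coordinate changes.\<close>

type_synonym ('a, 'n) form2 =
  "('a, 'n) chart \<Rightarrow> complex^'n \<Rightarrow> complex^'n \<Rightarrow> complex^'n \<Rightarrow> real"

definition smooth_form2 :: "('a, 'n::finite) chart set \<Rightarrow> ('a, 'n) form2 \<Rightarrow> bool" where
  "smooth_form2 A \<omega> \<longleftrightarrow>
     (\<forall>c\<in>A. (\<forall>z \<in> snd c ` fst c. bilinear (\<omega> c z) \<and> (\<forall>u. \<omega> c z u u = 0)) \<and>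
            (\<forall>u v. smooth_on (snd c ` fst c) (\<lambda>z. \<omega> c z u v))) \<and>
     (\<forall>c\<in>A. \<forall>c'\<in>A. \<forall>z \<in> snd c ` (fst c \<inter> fst c'). \<forall>u v.
        let \<tau> = snd c' \<circ> chart_inv c; D = frechet_derivative \<tau> (at z)
        in \<omega> c z u v = \<omega> c' (\<tau> z) (D u) (D v))"

text \<open>A Kaehler form is a closed, positive definite real (1,1)-form; type (1,1) amounts to
  invariance under multiplication by \<open>i\<close>.\<close>

definition kaehler_form :: "('a, 'n::finite) chart set \<Rightarrow> ('a, 'n) form2 \<Rightarrow> bool" where
  "kaehler_form A \<omega> \<longleftrightarrow> smooth_form2 A \<omega> \<and>
     (\<forall>c\<in>A. \<forall>z \<in> snd c ` fst c.
        (\<forall>u v w. ext_deriv2 (\<omega> c) z u v w = 0) \<and>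
        (\<forall>u v. \<omega> c z (\<i> *s u) (\<i> *s v) = \<omega> c z u v) \<and>
        (\<forall>u. u \<noteq> 0 \<longrightarrow> \<omega> c z u (\<i> *s u) > 0))"

definition kaehler_manifold :: "'a topology \<Rightarrow> ('a, 'n::finite) chart set \<Rightarrow> bool" where
  "kaehler_manifold X A \<longleftrightarrow> complex_manifold X A \<and> (\<exists>\<omega>. kaehler_form A \<omega>)"

section \<open>Holomorphic line bundles\<close>

text \<open>A line bundle comes with a trivializing cover \<open>Dom i\<close>, \<open>i \<in> Idx\<close>, of the base;
  \<open>Coord i\<close> is the fibre coordinate of the trivialization over \<open>Dom i\<close>, so that
  \<open>\<xi> \<mapsto> (Prj \<xi>, Coord i \<xi>)\<close> identifies the part of the bundle over \<open>Dom i\<close> with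
  \<open>Dom i \<times> \<complex>\<close>.\<close>

record ('a, 'e, 'i) line_bundle =
  Tot :: "'e set"
  Prj :: "'e \<Rightarrow> 'a"
  Add :: "'e \<Rightarrow> 'e \<Rightarrow> 'e"
  Scale :: "complex \<Rightarrow> 'e \<Rightarrow> 'e"
  Idx :: "'i set"
  Dom :: "'i \<Rightarrow> 'a set"
  Coord :: "'i \<Rightarrow> 'e \<Rightarrow> complex"

definition fibre :: "('a, 'e, 'i) line_bundle \<Rightarrow> 'a \<Rightarrow> 'e set" where
  "fibre L x = {\<xi> \<in> Tot L. Prj L \<xi> = x}"

definition frame :: "('a, 'e, 'i) line_bundle \<Rightarrow> 'i \<Rightarrow> 'a \<Rightarrow> 'e" where
  "frame L i x = inv_into (fibre L x) (Coord L i) 1"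

text \<open>Convention: \<open>Coord j \<xi> = g\<^sub>i\<^sub>j (Prj \<xi>) * Coord i \<xi>\<close>.\<close>

definition transition :: "('a, 'e, 'i) line_bundle \<Rightarrow> 'i \<Rightarrow> 'i \<Rightarrow> 'a \<Rightarrow> complex" where
  "transition L i j x = Coord L j (frame L i x)"

definition holomorphic_line_bundle ::
    "'a topology \<Rightarrow> ('a, 'n::finite) chart set \<Rightarrow> ('a, 'e, 'i) line_bundle \<Rightarrow> bool" where
  "holomorphic_line_bundle X A L \<longleftrightarrow>
     Prj L ` Tot L \<subseteq> topspace X \<and>
     (\<forall>i\<in>Idx L. openin X (Dom L i)) \<and> (\<Union>i\<in>Idx L. Dom L i) = topspace X \<and>
     (\<forall>x\<in>topspace X. \<forall>\<xi>\<in>fibre L x.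
        (\<forall>\<eta>\<in>fibre L x. Add L \<xi> \<eta> \<in> fibre L x) \<and> (\<forall>c. Scale L c \<xi> \<in> fibre L x)) \<and>
     (\<forall>i\<in>Idx L. \<forall>x\<in>Dom L i.
        bij_betw (Coord L i) (fibre L x) UNIV \<and>
        (\<forall>\<xi>\<in>fibre L x. \<forall>\<eta>\<in>fibre L x. Coord L i (Add L \<xi> \<eta>) = Coord L i \<xi> + Coord L i \<eta>) \<and>
        (\<forall>c. \<forall>\<xi>\<in>fibre L x. Coord L i (Scale L c \<xi>) = c * Coord L i \<xi>)) \<and>
     (\<forall>i\<in>Idx L. \<forall>j\<in>Idx L. mfd_holo_on A (Dom L i \<inter> Dom L j) (transition L i j))"

text \<open>Points of the dual bundle are pairs of a base point \<open>x\<close> and a linear functional on the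
  fibre over \<open>x\<close> (a function restricted to that fibre).\<close>

definition dual_bundle ::
    "('a, 'e, 'i) line_bundle \<Rightarrow> ('a, 'a \<times> ('e \<Rightarrow> complex), 'i) line_bundle" where
  "dual_bundle L = \<lparr>
     Tot = {(x, l). x \<in> Prj L ` Tot L \<and> l \<in> extensional (fibre L x) \<and>
              (\<forall>\<xi>\<in>fibre L x. \<forall>\<eta>\<in>fibre L x. l (Add L \<xi> \<eta>) = l \<xi> + l \<eta>) \<and>
              (\<forall>c. \<forall>\<xi>\<in>fibre L x. l (Scale L c \<xi>) = c * l \<xi>)},
     Prj = fst,
     Add = (\<lambda>(x, l) (y, m). (x, restrict (\<lambda>\<xi>. l \<xi> + m \<xi>) (fibre L x))),
     Scale = (\<lambda>c (x, l). (x, restrict (\<lambda>\<xi>. c * l \<xi>) (fibre L x))),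
     Idx = Idx L,
     Dom = Dom L,
     Coord = (\<lambda>i (x, l). l (frame L i x))\<rparr>"

text \<open>The complex structure of the total space, of dimension one more than the base: the charts
  are the products of base charts with fibre coordinates, the latter being the component
  \<open>None\<close>.\<close>

definition total_atlas ::
    "('a, 'n::finite) chart set \<Rightarrow> ('a, 'e, 'i) line_bundle \<Rightarrow> ('e, 'n option) chart set" where
  "total_atlas A L =
     (\<lambda>(c, i). ({\<xi> \<in> Tot L. Prj L \<xi> \<in> fst c \<inter> Dom L i},
        \<lambda>\<xi>. \<chi> k. case k of None \<Rightarrow> Coord L i \<xi> | Some m \<Rightarrow> snd c (Prj L \<xi>) $ m)) ` (A \<times> Idx L)"

section \<open>Metrics and homogeneous plurisubharmonic functions\<close>

text \<open>Singular metrics (as local weights): the value \<open>-\<infinity>\<close> is allowed. Metrics and functions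
  are made \<open>undefined\<close> outside their domains, so that distinct elements differ on the
  domain.\<close>

definition metrics :: "('a, 'e, 'i) line_bundle \<Rightarrow> ('i \<Rightarrow> 'a \<Rightarrow> ereal) set" where
  "metrics L =
     {h \<in> (\<Pi>\<^sub>E i\<in>Idx L. Dom L i \<rightarrow>\<^sub>E {-\<infinity>..<\<infinity>}).
        \<forall>i\<in>Idx L. \<forall>j\<in>Idx L. \<forall>x \<in> Dom L i \<inter> Dom L j.
          h j x = h i x + ereal (ln (cmod (transition L i j x)))}"

definition positive_metrics ::
    "('a, 'n::finite) chart set \<Rightarrow> ('a, 'e, 'i) line_bundle \<Rightarrow> ('i \<Rightarrow> 'a \<Rightarrow> ereal) set" where
  "positive_metrics A L = {h \<in> metrics L. \<forall>i\<in>Idx L. mfd_psh_on A (Dom L i) (h i)}"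

definition smooth_metrics ::
    "('a, 'n::finite) chart set \<Rightarrow> ('a, 'e, 'i) line_bundle \<Rightarrow> ('i \<Rightarrow> 'a \<Rightarrow> ereal) set" where
  "smooth_metrics A L =
     {h \<in> metrics L. \<forall>i\<in>Idx L.
        (\<forall>x\<in>Dom L i. h i x \<noteq> -\<infinity>) \<and> mfd_smooth_on A (Dom L i) (\<lambda>x. real_of_ereal (h i x))}"

definition positive_line_bundle ::
    "('a, 'n::finite) chart set \<Rightarrow> ('a, 'e, 'i) line_bundle \<Rightarrow> bool" where
  "positive_line_bundle A L \<longleftrightarrow>
     (\<exists>\<phi>\<in>smooth_metrics A L. \<exists>\<omega>. kaehler_form A \<omega> \<and>
        (\<forall>i\<in>Idx L. \<forall>c\<in>A. \<forall>z \<in> snd c ` (fst c \<inter> Dom L i).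
           \<omega> c z = ddc ((\<lambda>x. real_of_ereal (\<phi> i x)) \<circ> chart_inv c) z))"

definition abs_homogeneous ::
    "real \<Rightarrow> ('a, 'e, 'i) line_bundle \<Rightarrow> ('e \<Rightarrow> ereal) \<Rightarrow> bool" where
  "abs_homogeneous d L u \<longleftrightarrow>
     (\<forall>c. \<forall>\<xi>\<in>Tot L. u (Scale L c \<xi>) = ereal (cmod c powr d) * u \<xi>)"

definition homogeneous_psh ::
    "real \<Rightarrow> ('a, 'n::finite) chart set \<Rightarrow> ('a, 'e, 'i) line_bundle \<Rightarrow> ('e \<Rightarrow> ereal) set" where
  "homogeneous_psh d A L =
     {u \<in> extensional (Tot L).
        mfd_psh_on (total_atlas A L) (Tot L) u \<and>
        (\<forall>\<xi>\<in>Tot L. u \<xi> \<ge> 0) \<and> (\<exists>\<xi>\<in>Tot L. u \<xi> \<noteq> 0) \<and>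
        abs_homogeneous d L u}"

definition exp_ereal :: "ereal \<Rightarrow> ereal" where
  "exp_ereal x = (if x = -\<infinity> then 0 else if x = \<infinity> then \<infinity> else ereal (exp (real_of_ereal x)))"

text \<open>The function \<open>u\<close> on the total space of the dual bundle \<open>L'\<close> belongs to the
  metric \<open>h\<close> of \<open>L\<close> if, with \<open>log 0 = -\<infinity>\<close>, \<open>h\<^sub>i = (1/d) log u(e\<^sub>i\<^sup>*)\<close> for the dual frames
  \<open>e\<^sub>i\<^sup>*\<close>, i.e. if \<open>u\<close> is the \<open>d\<close>-th power of the norm on \<open>L'\<close>
  with weights \<open>h\<close>.\<close>

definition induces_metric ::
    "real \<Rightarrow> ('a, 'e, 'i) line_bundle \<Rightarrow> ('a \<times> ('e \<Rightarrow> complex) \<Rightarrow> ereal) \<Rightarrow>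
     ('i \<Rightarrow> 'a \<Rightarrow> ereal) \<Rightarrow> bool" where
  "induces_metric d L u h \<longleftrightarrow>
     (\<forall>i\<in>Idx L. \<forall>x\<in>Dom L i. \<forall>\<xi>\<in>fibre (dual_bundle L) x.
        u \<xi> = ereal (cmod (Coord (dual_bundle L) i \<xi>) powr d) * exp_ereal (ereal d * h i x))"

end

theory Submission
  imports Defs "HOL-Complex_Analysis.Complex_Analysis"
begin

text \<open>
  A function \<open>u\<close> on the dual bundle that is absolutely homogeneous of order \<open>d\<close> is determined by
  its values on the dual frames: in the trivialization with index \<open>i\<close> it reads
  \<open>u(x, t) = \<bar>t\<bar>\<^sup>d exp (d h\<^sub>i(x))\<close>, where \<open>h\<^sub>i = (1/d) log u(e\<^sub>i\<^sup>*)\<close>. The fibre coordinate of \<open>L'\<close> changes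
  by the inverse of the transition function of \<open>L\<close>, which is precisely the rule
  \<open>h\<^sub>j = h\<^sub>i + log \<bar>g\<^sub>i\<^sub>j\<bar>\<close> for the local weights of a metric. So homogeneous nonnegative functions on
  \<open>L'\<close> and metrics on \<open>L\<close> determine each other, and the content of the theorem is local:
  \<open>\<bar>t\<bar>\<^sup>d exp (d h)\<close> is plurisubharmonic in \<open>(x, t)\<close> if and only if \<open>h\<close> is plurisubharmonic in \<open>x\<close>.

  From \<open>h\<close> to \<open>u\<close> (\<open>psh_homogeneous_extension\<close>): \<open>log u = d (log \<bar>t\<bar> + h)\<close> satisfies the mean value
  inequality on every disc, because \<open>log \<bar>\<alpha> + \<beta>\<zeta>\<bar>\<close> does (\<open>mean_ln_affine_ge\<close>), and Jensen's
  inequality for the exponential function transfers it to \<open>u\<close>.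

  From \<open>u\<close> to \<open>h\<close> (\<open>log_psh_of_homogeneous_extension\<close>): plurisubharmonicity is tested on affine
  discs only, and on an affine disc of the total space, \<open>u\<close> restricts to
  \<open>\<bar>1 + s\<zeta>\<bar>\<^sup>d exp (d k(\<zeta>))\<close>, with \<open>k\<close> the restriction of \<open>h\<close> to a disc and \<open>s\<close> at our disposal.
  Suppose the mean value inequality fails for \<open>k\<close> on the unit disc. Then some harmonic polynomial
  \<open>Re p\<close> dominates \<open>k\<close> on the unit circle but lies below \<open>k\<close> at the centre, so that \<open>k\<close> is touched
  from above at an interior point \<open>b\<close> by \<open>Re p - \<epsilon> \<bar>\<zeta>\<bar>\<^sup>2\<close>, after a constant is added to \<open>p\<close>
  (\<open>interior_touching\<close>). Choose \<open>s\<close> such that \<open>log \<bar>1 + s(\<zeta> - b)\<bar>\<close> cancels the gradient of this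
  function at \<open>b\<close>. The Laplacian of \<open>exp (d f)\<close> is \<open>exp (d f) (d \<Delta>f + d\<^sup>2 \<bar>\<nabla>f\<bar>\<^sup>2)\<close>, so with the gradient
  gone the exponential of the touching function is strictly superharmonic at \<open>b\<close>
  (\<open>affine_factor_strict_supermean\<close>). As it touches \<open>u\<close> from above, this contradicts the mean value
  inequality for \<open>u\<close> on small discs.

  It remains to see that \<open>h\<^sub>i\<close> is not identically \<open>-\<infinity>\<close> on a component of a coordinate domain. If it
  were, the interior of the set of base points over which \<open>u\<close> vanishes would be nonempty. That
  interior is also closed (\<open>minus_infinity_propagates\<close>), hence everything by connectedness, and \<open>u\<close>
  would vanish identically (\<open>minus_infinity_everywhere\<close>).
\<close>

section \<open>Means over the unit circle\<close>

abbreviation circle_measure :: "real measure" where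
  "circle_measure \<equiv> uniform_measure lborel {0..2*pi}"

lemma emeasure_circle_measure_space: "emeasure circle_measure UNIV = 1"
proof -
  have "emeasure circle_measure UNIV = emeasure lborel ({0..2*pi} \<inter> UNIV) / emeasure lborel {0..2*pi}"
    by (rule emeasure_uniform_measure) auto
  also have "\<dots> = 1"
    by (simp add: ennreal_divide_self)
  finally show ?thesis .
qed

lemma finite_circle_measure [simp]: "finite_measure circle_measure"
  by (rule finite_measureI) (simp add: emeasure_circle_measure_space)

lemma nn_integral_circle_const: "(\<integral>\<^sup>+t. c \<partial>circle_measure) = c"
  by (simp add: emeasure_circle_measure_space)

lemma measure_circle_measure_UNIV: "measure circle_measure UNIV = 1"
  by (simp add: measure_def emeasure_circle_measure_space)

lemma measurable_circle_measure [simp]: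
  "borel_measurable circle_measure = borel_measurable borel"
  by (rule measurable_cong_sets) auto

lemma integrable_circle_bounded:
  fixes f :: "real \<Rightarrow> real"
  assumes "f \<in> borel_measurable borel" and "\<And>t. \<bar>f t\<bar> \<le> B"
  shows "integrable circle_measure f"
  by (rule finite_measure.integrable_const_bound[where B = B]) (use assms in auto)

lemma integrable_circle_continuous:
  fixes f :: "real \<Rightarrow> real"
  assumes f: "continuous_on UNIV f" and B: "\<And>t. \<bar>f t\<bar> \<le> B"
  shows "integrable circle_measure f"
  by (rule integrable_circle_bounded[OF borel_measurable_continuous_onI[OF f] B])

lemma integral_circle_eq_integral:
  fixes f :: "real \<Rightarrow> real"
  assumes f: "continuous_on UNIV f"
  shows "(\<integral>t. f t \<partial>circle_measure) = integral {0..2*pi} f / (2*pi)"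
proof -
  have [measurable]: "f \<in> borel_measurable borel"
    by (rule borel_measurable_continuous_onI[OF f])
  have c: "continuous_on {0..2*pi} f" using f continuous_on_subset by blast
  have "circle_measure = density lborel (\<lambda>t. ennreal (indicator {0..2*pi} t / (2*pi)))"
    unfolding uniform_measure_def
    by (rule density_cong) (auto simp: divide_ennreal ennreal_indicator[symmetric] split: split_indicator)
  then have "(\<integral>t. f t \<partial>circle_measure) = (\<integral>t. (indicator {0..2*pi} t / (2*pi)) *\<^sub>R f t \<partial>lborel)"
    by (simp add: integral_density)
  also have "\<dots> = (\<integral>t. (indicator {0..2*pi} t * f t) / (2*pi) \<partial>lborel)"
    by (simp add: field_simps)
  also have "\<dots> = (\<integral>t. indicator {0..2*pi} t * f t \<partial>lborel) / (2*pi)"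
    by simp
  also have "(\<integral>t. indicator {0..2*pi} t * f t \<partial>lborel) = integral {0..2*pi} f"
    using set_borel_integral_eq_integral(2)[OF borel_integrable_atLeastAtMost'[OF c]]
    by (simp add: set_lebesgue_integral_def)
  finally show ?thesis .
qed

text \<open>Cauchy's integral formula at the centre, written as an integral over the angle.\<close>

lemma circle_mean_Re_holomorphic:
  assumes f: "f holomorphic_on ball 0 R" and R: "R > 1"
  shows "(\<integral>t. Re (f (cis t)) \<partial>circle_measure) = Re (f 0)"
proof -
  have sub: "cball 0 1 \<subseteq> ball (0::complex) R" using R by auto
  have cf: "continuous_on (ball 0 R) f" by (rule holomorphic_on_imp_continuous_on[OF f])
  have c: "continuous_on UNIV (\<lambda>t. f (cis t))"
    by (rule continuous_on_compose2[OF cf]) (use R in \<open>auto intro!: continuous_intros\<close>)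
  have "((\<lambda>u. f u / (u - 0)) has_contour_integral (2 * of_real pi * \<i> * f 0)) (circlepath 0 1)"
    by (rule Cauchy_integral_circlepath_simple) (use holomorphic_on_subset[OF f sub] in auto)
  then have "((\<lambda>x::real. (2 * of_real pi * \<i>) * f (cis (2 * pi * x))) has_integral ((2 * of_real pi * \<i>) * f 0)) {0..1}"
    unfolding has_contour_integral_def
  proof (rule has_integral_eq[rotated])
    fix x :: real assume x: "x \<in> {0..1}"
    show "f (circlepath 0 1 x) / (circlepath 0 1 x - 0) * vector_derivative (circlepath 0 1) (at x within {0..1})
        = (2 * of_real pi * \<i>) * f (cis (2 * pi * x))"
      using x by (simp add: vector_derivative_circlepath01) (simp add: circlepath cis_conv_exp mult_ac)
  qed
  from has_integral_mult_right[OF this, of "1 / (2 * of_real pi * \<i>)"]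
  have "((\<lambda>x::real. f (cis (2 * pi * x))) has_integral f 0) {0..1}" by simp
  from has_integral_stretch_real[OF this, of "1/(2*pi)"]
  have "((\<lambda>t. f (cis t)) has_integral (2*pi) *\<^sub>R f 0) {0..2*pi}"
    by (simp add: image_mult_atLeastAtMost mult.commute[of _ "pi * 2"] mult.commute[of 2 pi])
  then have "((\<lambda>t. Re (f (cis t))) has_integral Re ((2*pi) *\<^sub>R f 0)) {0..2*pi}"
    by (rule has_integral_Re)
  then have "integral {0..2*pi} (\<lambda>t. Re (f (cis t))) = 2*pi * Re (f 0)"
    by (simp add: integral_unique)
  moreover have "continuous_on UNIV (\<lambda>t. Re (f (cis t)))"
    by (intro continuous_intros c)
  ultimately show ?thesis by (simp add: integral_circle_eq_integral)
qed

text \<open>Here \<open>a + b\<zeta>\<close> has no zero in the closed disc, so its logarithm is the real part of a holomorphic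
  function. The factor \<open>a\<close> is split off to keep \<open>1 + (b/a)\<zeta>\<close> in the right half plane, where the
  principal branch applies.\<close>

lemma mean_ln_affine_less:
  assumes "cmod b < cmod a"
  shows "(\<integral>t. ln (cmod (a + b * cis t)) \<partial>circle_measure) = ln (cmod a)"
proof (cases "b = 0")
  case True
  then show ?thesis by (simp add: measure_circle_measure_UNIV)
next
  case False
  define c where "c = b / a"
  have a: "a \<noteq> 0" using assms by auto
  have c0: "c \<noteq> 0" using False a by (simp add: c_def)
  have c1: "cmod c < 1" using assms a by (simp add: c_def norm_divide)
  have pos: "0 < Re (1 + c * z)" if "cmod z < 1 / cmod c" for z
  proof -
    have "cmod (c * z) < 1" using that c0 by (simp add: norm_mult field_simps)
    then have "\<bar>Re (c * z)\<bar> < 1" using abs_Re_le_cmod le_less_trans by blast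
    then show ?thesis by (simp del: times_complex.sel)
  qed
  have hol: "(\<lambda>z. Ln (1 + c * z)) holomorphic_on ball 0 (1 / cmod c)"
    by (intro holomorphic_intros) (auto simp: complex_nonpos_Reals_iff not_le simp del: times_complex.sel dest!: pos)
  have ne: "1 + c * cis t \<noteq> 0" for t
    using pos[of "cis t"] c1 c0 by (force simp: field_simps simp del: times_complex.sel plus_complex.sel)
  have e: "ln (cmod (a + b * cis t)) = ln (cmod a) + Re (Ln (1 + c * cis t))" for t
  proof -
    have "a + b * cis t = a * (1 + c * cis t)" using a by (simp add: c_def field_simps)
    then show ?thesis using a ne[of t] by (simp add: norm_mult ln_mult)
  qed
  have cont: "continuous_on UNIV (\<lambda>t. Re (Ln (1 + c * cis t)))"
  proof (rule continuous_on_Re)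
    show "continuous_on UNIV (\<lambda>t. Ln (1 + c * cis t))"
      by (rule continuous_on_compose2[OF holomorphic_on_imp_continuous_on[OF hol]])
        (use c0 c1 in \<open>auto intro!: continuous_intros simp: field_simps\<close>)
  qed
  have bd: "bounded (range (\<lambda>t. Re (Ln (1 + c * cis t))))"
  proof -
    have "compact ((\<lambda>z. Re (Ln (1 + c * z))) ` sphere 0 1)"
      by (intro compact_continuous_image continuous_intros
          continuous_on_subset[OF holomorphic_on_imp_continuous_on[OF hol]])
        (use c0 c1 in \<open>auto simp: field_simps\<close>)
    then show ?thesis
      by (rule bounded_subset[OF compact_imp_bounded]) (auto)
  qed
  then obtain B where "\<And>t. \<bar>Re (Ln (1 + c * cis t))\<bar> \<le> B"
    by (auto simp: bounded_iff)
  then have int: "integrable circle_measure (\<lambda>t. Re (Ln (1 + c * cis t)))"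
    by (rule integrable_circle_continuous[OF cont])
  have "(\<integral>t. Re (Ln (1 + c * cis t)) \<partial>circle_measure) = Re (Ln (1 + c * 0))"
    by (rule circle_mean_Re_holomorphic[OF hol]) (use c1 c0 in \<open>simp add: field_simps\<close>)
  then have i0: "(\<integral>t. Re (Ln (1 + c * cis t)) \<partial>circle_measure) = 0" by simp
  have ic: "integrable circle_measure (\<lambda>t. ln (cmod a))"
    by (rule finite_measure.integrable_const) simp
  show ?thesis
    unfolding e Bochner_Integration.integral_add[OF ic int] i0 by (simp add: measure_circle_measure_UNIV)
qed

text \<open>The mean is \<open>max (log \<bar>a\<bar>) (log \<bar>b\<bar>)\<close>. If \<open>\<bar>b\<bar> > \<bar>a\<bar>\<close>, the roles of \<open>a\<close> and \<open>b\<close> are exchanged by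
  conjugation, since \<open>\<bar>\<zeta>\<bar> = 1\<close>. The remaining case \<open>\<bar>a\<bar> = \<bar>b\<bar>\<close>, with its zero on the circle, is reached
  by a limit in \<open>submean_homogeneous_extension\<close>.\<close>

lemma mean_ln_affine_ge:
  assumes "cmod b \<noteq> cmod a" "a \<noteq> 0"
  shows "(\<integral>t. ln (cmod (a + b * cis t)) \<partial>circle_measure) \<ge> ln (cmod a)"
proof (cases "cmod b < cmod a")
  case True
  then show ?thesis by (simp add: mean_ln_affine_less)
next
  case False
  have "cmod (a + b * cis t) = cmod (cnj b + cnj a * cis t)" for t
  proof -
    have "cmod (a + b * cis t) = cmod (cnj (a + b * cis t) * cis t)"
      by (simp add: norm_mult del: complex_cnj_add)
    also have "cnj (a + b * cis t) * cis t = cnj b + cnj a * cis t"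
      by (simp add: algebra_simps cis_cnj cis_mult)
    finally show ?thesis .
  qed
  moreover have "cmod (cnj a) < cmod (cnj b)" using False assms by simp
  ultimately have "(\<integral>t. ln (cmod (a + b * cis t)) \<partial>circle_measure) = ln (cmod b)"
    using mean_ln_affine_less[of "cnj a" "cnj b"] by simp
  moreover have "ln (cmod a) \<le> ln (cmod b)"
    using False assms(2) by (intro ln_mono) (auto intro: less_le_trans[of _ "cmod a"])
  ultimately show ?thesis by simp
qed

section \<open>Extended real integrals and semicontinuous functions\<close>

lemma ereal_integral_mono:
  assumes "\<And>x. x \<in> space M \<Longrightarrow> f x \<le> g x"
  shows "ereal_integral M f \<le> ereal_integral M g"
  unfolding ereal_integral_def
  by (intro ereal_minus_mono iffD1[OF less_eq_ennreal.rep_eq] nn_integral_mono e2ennreal_mono)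
    (use assms in \<open>auto simp: ereal_minus_le_minus\<close>)

lemma ereal_integral_nonneg:
  assumes "\<And>x. x \<in> space M \<Longrightarrow> f x \<ge> 0"
  shows "ereal_integral M f = enn2ereal (\<integral>\<^sup>+x. e2ennreal (f x) \<partial>M)"
proof -
  have "(\<integral>\<^sup>+x. e2ennreal (- f x) \<partial>M) = (\<integral>\<^sup>+x. 0 \<partial>M)"
    by (intro nn_integral_cong) (use assms in \<open>auto simp: e2ennreal_neg\<close>)
  then show ?thesis by (simp add: ereal_integral_def zero_ennreal.rep_eq)
qed

lemma ereal_integral_real:
  assumes "integrable M g"
  shows "ereal_integral M (\<lambda>x. ereal (g x)) = ereal (integral\<^sup>L M g)"
proof -
  have fin: "(\<integral>\<^sup>+x. ennreal (g x) \<partial>M) < \<infinity>" "(\<integral>\<^sup>+x. ennreal (- g x) \<partial>M) < \<infinity>"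
    using assms integrableD(2)[of M g] integrableD(2)[of M "\<lambda>x. - g x"] by (auto simp: real_integrable_def less_top)
  from fin show ?thesis
    unfolding ereal_integral_def uminus_ereal.simps e2ennreal_ereal real_lebesgue_integral_def[OF assms]
    by (cases "\<integral>\<^sup>+x. ennreal (g x) \<partial>M"; cases "\<integral>\<^sup>+x. ennreal (- g x) \<partial>M") (auto simp: enn2ereal_ennreal)
qed

text \<open>For functions bounded above, the extended real integral becomes a single integral of the
  nonnegative function \<open>B - f\<close>, to which monotone convergence applies.\<close>

lemma ereal_integral_circle_bounded_above:
  assumes [measurable]: "f \<in> borel_measurable borel" and f: "\<And>t. f t \<le> ereal B" and B: "B \<ge> 0"
  shows "ereal_integral circle_measure f
    = ereal B - enn2ereal (\<integral>\<^sup>+t. e2ennreal (ereal B - f t) \<partial>circle_measure)"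
proof -
  let ?p = "\<integral>\<^sup>+t. e2ennreal (f t) \<partial>circle_measure"
  let ?n = "\<integral>\<^sup>+t. e2ennreal (- f t) \<partial>circle_measure"
  let ?q = "\<integral>\<^sup>+t. e2ennreal (ereal B - f t) \<partial>circle_measure"
  have "?p \<le> (\<integral>\<^sup>+t. ennreal B \<partial>circle_measure)"
    by (intro nn_integral_mono) (use f e2ennreal_mono in \<open>fastforce simp flip: e2ennreal_ereal\<close>)
  then have p: "?p < \<infinity>" by (simp add: nn_integral_circle_const le_less_trans del: nn_integral_const)
  have "?q + ?p = (\<integral>\<^sup>+t. e2ennreal (ereal B - f t) + e2ennreal (f t) \<partial>circle_measure)"
    by (subst nn_integral_add) auto
  also have "\<dots> = (\<integral>\<^sup>+t. ennreal B + e2ennreal (- f t) \<partial>circle_measure)"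
  proof (intro nn_integral_cong)
    fix t
    show "e2ennreal (ereal B - f t) + e2ennreal (f t) = ennreal B + e2ennreal (- f t)"
      using f[of t] B by (cases "f t"; cases "f t \<ge> 0")
        (auto simp: ennreal_neg e2ennreal_neg ennreal_plus[symmetric] simp del: ennreal_plus)
  qed
  also have "\<dots> = ennreal B + ?n"
    by (subst nn_integral_add) (auto simp: nn_integral_circle_const simp del: nn_integral_const)
  finally have eq: "?q + ?p = ennreal B + ?n" .
  show ?thesis
    unfolding ereal_integral_def using p eq B
    by (cases ?p; cases ?n; cases ?q)
      (auto simp: enn2ereal_ennreal ennreal_plus[symmetric] top_add add_top ennreal_inj simp del: ennreal_plus)
qed

text \<open>A lower bound for the mean makes the function integrable, so that Jensen's inequality can be
  carried out with real integrals.\<close>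

lemma ereal_integral_circle_ge_real:
  assumes [measurable]: "f \<in> borel_measurable borel" and f: "\<And>t. f t \<le> ereal B" and B: "B \<ge> 0"
    and m: "ereal m \<le> ereal_integral circle_measure f"
  shows "AE t in circle_measure. f t \<noteq> -\<infinity>"
    and "integrable circle_measure (\<lambda>t. real_of_ereal (f t))"
    and "m \<le> (\<integral>t. real_of_ereal (f t) \<partial>circle_measure)"
proof -
  let ?q = "\<integral>\<^sup>+t. e2ennreal (ereal B - f t) \<partial>circle_measure"
  have m': "ereal m \<le> ereal B - enn2ereal ?q"
    using m ereal_integral_circle_bounded_above[OF assms(1) f B] by simp
  then have q: "?q < \<infinity>"
    by (cases "?q = top") (auto simp: less_top enn2ereal_top)
  then have "AE t in circle_measure. e2ennreal (ereal B - f t) \<noteq> \<infinity>"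
    by (intro nn_integral_PInf_AE) auto
  then show ae: "AE t in circle_measure. f t \<noteq> -\<infinity>"
    by eventually_elim auto
  have le: "real_of_ereal (f t) \<le> B" for t using f[of t] B by (cases "f t") auto
  have qe: "(\<integral>\<^sup>+t. ennreal (B - real_of_ereal (f t)) \<partial>circle_measure) = ?q"
  proof (rule nn_integral_cong_AE, use ae in eventually_elim)
    case (elim t)
    then show ?case using f[of t] by (cases "f t") auto
  qed
  have int: "integrable circle_measure (\<lambda>t. B - real_of_ereal (f t))"
    by (rule integrableI_nonneg) (use le q in \<open>auto simp: qe\<close>)
  have "integrable circle_measure (\<lambda>t. B - (B - real_of_ereal (f t)))"
    by (intro Bochner_Integration.integrable_diff int finite_measure.integrable_const) auto
  then show int': "integrable circle_measure (\<lambda>t. real_of_ereal (f t))" by simp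
  have "ennreal (\<integral>t. B - real_of_ereal (f t) \<partial>circle_measure) = ?q"
    using nn_integral_eq_integral[OF int] le by (simp add: qe)
  moreover have "0 \<le> (\<integral>t. B - real_of_ereal (f t) \<partial>circle_measure)"
    using le by (intro Bochner_Integration.integral_nonneg) auto
  ultimately have "enn2ereal ?q = ereal (\<integral>t. B - real_of_ereal (f t) \<partial>circle_measure)"
    by (metis enn2ereal_ennreal)
  also have "(\<integral>t. B - real_of_ereal (f t) \<partial>circle_measure) = B - (\<integral>t. real_of_ereal (f t) \<partial>circle_measure)"
    by (subst Bochner_Integration.integral_diff) (auto simp: int' measure_circle_measure_UNIV finite_measure.integrable_const)
  finally show "m \<le> (\<integral>t. real_of_ereal (f t) \<partial>circle_measure)"
    using m' by simp
qed

lemma usc_attains_max: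
  fixes v :: "'x::topological_space \<Rightarrow> 'y::linorder"
  assumes K: "compact K" "K \<noteq> {}"
    and usc: "\<And>c. openin (top_of_set K) {z\<in>K. v z < c}"
  obtains b where "b \<in> K" "\<And>z. z \<in> K \<Longrightarrow> v z \<le> v b"
proof (rule ccontr)
  assume "\<not> thesis"
  with that have ex: "\<forall>b\<in>K. \<exists>z\<in>K. v b < v z" by (meson not_le)
  have "\<forall>y\<in>K. \<exists>T. open T \<and> {z\<in>K. v z < v y} = K \<inter> T"
    using usc by (simp add: openin_open)
  then obtain T where T: "\<And>y. y \<in> K \<Longrightarrow> open (T y)" "\<And>y. y \<in> K \<Longrightarrow> {z\<in>K. v z < v y} = K \<inter> T y"
    by metis
  have "K \<subseteq> (\<Union>y\<in>K. T y)" using ex T(2) by blast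
  then obtain F where F: "F \<subseteq> K" "finite F" "K \<subseteq> (\<Union>y\<in>F. T y)"
    using compactE_image[OF K(1), of K T] T(1) by blast
  then have "F \<noteq> {}" using K(2) by blast
  have "Max (v ` F) \<in> v ` F" using F(2) \<open>F \<noteq> {}\<close> by simp
  then obtain y where "y \<in> F" "v y = Max (v ` F)" by auto
  then have y: "y \<in> F" "\<And>x. x \<in> F \<Longrightarrow> v x \<le> v y" using F(2) by auto
  obtain x where "x \<in> F" "y \<in> T x" using F y(1) by blast
  then have "v y < v x" using T(2)[of x] F(1) y(1) by blast
  with y(2)[OF \<open>x \<in> F\<close>] show False by simp
qed

text \<open>An upper semicontinuous function is the decreasing limit of its Lipschitz regularizations
  \<open>g\<^sub>n(x) = sup\<^sub>y (max (k y) (-n) - n \<bar>x - y\<bar>)\<close>, and by monotone convergence the mean of some \<open>g\<^sub>n\<close> falls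
  below any number above the mean of \<open>k\<close>. The truncation at \<open>-n\<close> keeps \<open>g\<^sub>n\<close> real valued where \<open>k\<close> is
  \<open>-\<infinity>\<close>.\<close>

lemma usc_continuous_majorant:
  fixes k :: "complex \<Rightarrow> ereal"
  assumes usc: "\<And>c. openin (top_of_set (sphere 0 1)) {z\<in>sphere 0 1. k z < c}"
    and fin: "\<And>z. z \<in> sphere 0 1 \<Longrightarrow> k z < \<infinity>"
    and meas [measurable]: "(\<lambda>t. k (cis t)) \<in> borel_measurable borel"
    and m: "ereal_integral circle_measure (\<lambda>t. k (cis t)) < ereal m"
  obtains g :: "complex \<Rightarrow> real" where "continuous_on UNIV g" "\<And>z. z \<in> sphere 0 1 \<Longrightarrow> k z \<le> ereal (g z)"
    "(\<integral>t. g (cis t) \<partial>circle_measure) < m"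
proof -
  let ?S = "sphere (0::complex) 1"
  have S1: "1 \<in> ?S" by simp
  obtain b where b: "b \<in> ?S" "\<And>z. z \<in> ?S \<Longrightarrow> k z \<le> k b"
    using usc_attains_max[OF compact_sphere _ usc] S1 by (metis empty_iff)
  define B where "B = max 0 (real_of_ereal (k b))"
  have kB: "k z \<le> ereal B" if "z \<in> ?S" for z
    using b(2)[OF that] fin[OF b(1)] by (cases "k b"; cases "k z") (auto simp: B_def max_def)
  have B: "B \<ge> 0" by (simp add: B_def)
  define \<tau> where "\<tau> n y = real_of_ereal (max (k y) (ereal (- real n)))" for n y
  have \<tau>: "ereal (\<tau> n y) = max (k y) (ereal (- real n))" if "y \<in> ?S" for n y
    using fin[OF that] by (cases "k y") (auto simp: \<tau>_def max_def)
  have \<tau>B: "\<tau> n y \<le> B" if "y \<in> ?S" for n y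
  proof -
    have "ereal (\<tau> n y) \<le> ereal B" unfolding \<tau>[OF that] using kB[OF that] B by simp
    then show ?thesis by simp
  qed
  define g where "g n x = (SUP y\<in>?S. \<tau> n y - real n * dist x y)" for n x
  have upper: "\<tau> n y - real n * dist x y \<le> B" if "y \<in> ?S" for n x y
    using \<tau>B[OF that, of n] by (smt (verit) mult_nonneg_nonneg of_nat_0_le_iff zero_le_dist)
  have bdd: "bdd_above ((\<lambda>y. \<tau> n y - real n * dist x y) ` ?S)" for n x
    using upper by (intro bdd_aboveI2[of _ _ B]) auto
  have gB: "g n x \<le> B" for n x
    unfolding g_def by (intro cSUP_least) (use S1 upper in blast)+
  have g\<tau>: "\<tau> n x \<le> g n x" if "x \<in> ?S" for n x
    unfolding g_def by (rule cSUP_upper2[OF bdd that]) simp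
  have gk: "k x \<le> ereal (g n x)" if "x \<in> ?S" for n x
  proof -
    have "k x \<le> ereal (\<tau> n x)" by (simp add: \<tau>[OF that])
    also have "\<dots> \<le> ereal (g n x)" using g\<tau>[OF that] by simp
    finally show ?thesis .
  qed
  have lip: "g n x \<le> g n x' + real n * dist x x'" for n x x'
    unfolding g_def
  proof (rule cSUP_least)
    show "?S \<noteq> {}" using S1 by blast
    fix y assume y: "y \<in> ?S"
    have "real n * dist x' y \<le> real n * (dist x y + dist x x')"
      by (intro mult_left_mono) (auto simp: dist_triangle3 add.commute)
    then have "\<tau> n y - real n * dist x y \<le> (\<tau> n y - real n * dist x' y) + real n * dist x x'"
      by (simp add: algebra_simps)
    also have "\<tau> n y - real n * dist x' y \<le> (SUP y\<in>?S. \<tau> n y - real n * dist x' y)"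
      by (rule cSUP_upper[OF y bdd])
    finally show "\<tau> n y - real n * dist x y \<le> (SUP y\<in>?S. \<tau> n y - real n * dist x' y) + real n * dist x x'"
      by simp
  qed
  have cont: "continuous_on UNIV (g n)" for n
  proof -
    have "n-lipschitz_on UNIV (g n)"
    proof (rule lipschitz_onI)
      fix x x' show "dist (g n x) (g n x') \<le> real n * dist x x'"
        using lip[of n x x'] lip[of n x' x] by (simp add: dist_real_def dist_commute abs_le_iff)
    qed simp
    then show ?thesis by (rule lipschitz_on_continuous_on)
  qed
  have cont': "continuous_on UNIV (\<lambda>t. g n (cis t))" for n
    by (rule continuous_on_compose2[OF cont]) (auto intro!: continuous_intros)
  have meas_g [measurable]: "(\<lambda>t. g n (cis t)) \<in> borel_measurable borel" for n
    by (rule borel_measurable_continuous_onI[OF cont'])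
  have dec: "g (Suc n) x \<le> g n x" for n x
    unfolding g_def
  proof (rule cSUP_mono)
    show "?S \<noteq> {}" using S1 by blast
    fix y assume y: "y \<in> ?S"
    have "ereal (\<tau> (Suc n) y) \<le> ereal (\<tau> n y)"
      unfolding \<tau>[OF y] by (intro max.mono) auto
    moreover have "real n * dist x y \<le> real (Suc n) * dist x y"
      by (intro mult_right_mono) auto
    ultimately show "\<exists>z\<in>?S. \<tau> (Suc n) y - real (Suc n) * dist x y \<le> \<tau> n z - real n * dist x z"
      using y by (intro bexI[of _ y]) auto
  qed (rule bdd)
  have sup: "(SUP n. ennreal (B - g n x)) = e2ennreal (ereal B - k x)" if x: "x \<in> ?S" for x
  proof (rule antisym)
    show "(SUP n. ennreal (B - g n x)) \<le> e2ennreal (ereal B - k x)"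
    proof (rule SUP_least)
      fix n
      have "ereal (B - g n x) \<le> ereal B - k x"
        using gk[OF x, of n] by (cases "k x") auto
      then show "ennreal (B - g n x) \<le> e2ennreal (ereal B - k x)"
        unfolding e2ennreal_ereal[symmetric] by (rule e2ennreal_mono)
    qed
    show "e2ennreal (ereal B - k x) \<le> (SUP n. ennreal (B - g n x))"
    proof (rule dense_le)
      fix y assume y: "y < e2ennreal (ereal B - k x)"
      then obtain r where r: "r \<ge> 0" "y = ennreal r"
        by (cases y) auto
      define c where "c = B - r"
      have kc: "k x < ereal c"
        using y fin[OF x] r by (cases "k x") (auto simp: c_def ennreal_less_iff)
      from usc[of "ereal c"] obtain T where T: "open T" "{z\<in>?S. k z < ereal c} = ?S \<inter> T"
        by (auto simp: openin_open)
      then have "x \<in> T" using x kc by blast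
      then obtain \<delta> where \<delta>: "\<delta> > 0" "ball x \<delta> \<subseteq> T" using T(1) openE by blast
      obtain n1 :: nat where n1: "- c \<le> real n1" using real_arch_simple by blast
      obtain n2 :: nat where n2: "(B - c) / \<delta> \<le> real n2" using real_arch_simple by blast
      \<comment> \<open>points near \<open>x\<close> contribute at most \<open>max c (- n)\<close> to the supremum, the others at most \<open>B - n \<delta>\<close>\<close>
      define n where "n = max n1 n2"
      have n: "- real n \<le> c" "B - real n * \<delta> \<le> c"
      proof -
        show "- real n \<le> c" using n1 by (simp add: n_def)
        have "(B - c) / \<delta> \<le> real n" using n2 by (simp add: n_def)
        then show "B - real n * \<delta> \<le> c" using \<delta>(1) by (simp add: field_simps)
      qed
      have "g n x \<le> c" unfolding g_def
      proof (rule cSUP_least)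
        show "?S \<noteq> {}" using S1 by blast
        fix z assume z: "z \<in> ?S"
        show "\<tau> n z - real n * dist x z \<le> c"
        proof (cases "dist x z < \<delta>")
          case True
          then have "z \<in> ?S \<inter> T" using \<delta>(2) z by auto
          then have "k z < ereal c" using T(2) by blast
          then have "ereal (\<tau> n z) \<le> ereal c" unfolding \<tau>[OF z] using n(1) by simp
          then have "\<tau> n z \<le> c" by simp
          moreover have "0 \<le> real n * dist x z" by simp
          ultimately show ?thesis by linarith
        next
          case False
          then have "real n * \<delta> \<le> real n * dist x z" by (intro mult_left_mono) auto
          then show ?thesis using n(2) \<tau>B[OF z, of n] by linarith
        qed
      qed
      then have "y \<le> ennreal (B - g n x)" unfolding r(2) by (intro ennreal_leI) (simp add: c_def)
      then show "y \<le> (SUP n. ennreal (B - g n x))" by (rule SUP_upper2[rotated]) simp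
    qed
  qed
  show ?thesis
  \<comment> \<open>if \<open>m\<close> exceeds the bound \<open>B\<close>, a constant will do; otherwise \<open>B - m\<close> is a nonnegative real, as needed for \<open>ennreal\<close>\<close>
  proof (cases "B < m")
    case True
    show ?thesis
      by (rule that[of "\<lambda>_. B"]) (use kB True in \<open>auto simp: measure_circle_measure_UNIV\<close>)
  next
    case False
    let ?q = "\<integral>\<^sup>+t. e2ennreal (ereal B - k (cis t)) \<partial>circle_measure"
    have "ereal B - enn2ereal ?q < ereal m"
      using m ereal_integral_circle_bounded_above[OF meas, of B] kB B by simp
    then have "ennreal (B - m) < ?q"
      using False by (cases ?q) (auto simp: enn2ereal_ennreal ennreal_less_iff)
    also have "?q = (\<integral>\<^sup>+t. (SUP n. ennreal (B - g n (cis t))) \<partial>circle_measure)"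
      by (intro nn_integral_cong) (simp add: sup)
    also have "\<dots> = (SUP n. \<integral>\<^sup>+t. ennreal (B - g n (cis t)) \<partial>circle_measure)"
      by (intro nn_integral_monotone_convergence_SUP incseq_SucI le_funI ennreal_leI) (auto simp: dec)
    finally obtain n where n: "ennreal (B - m) < (\<integral>\<^sup>+t. ennreal (B - g n (cis t)) \<partial>circle_measure)"
      by (auto simp: less_SUP_iff)
    have bd: "\<bar>g n (cis t)\<bar> \<le> max B (real n)" for t
    proof -
      have "ereal (- real n) \<le> ereal (\<tau> n (cis t))" by (subst \<tau>) auto
      then have "- real n \<le> g n (cis t)" using g\<tau>[of "cis t" n] by simp
      then show ?thesis using gB[of n "cis t"] by simp
    qed
    have int: "integrable circle_measure (\<lambda>t. g n (cis t))"
      by (rule integrable_circle_continuous[OF cont' bd])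
    have int': "integrable circle_measure (\<lambda>t. B - g n (cis t))"
      by (intro Bochner_Integration.integrable_diff int finite_measure.integrable_const) simp
    have "(\<integral>\<^sup>+t. ennreal (B - g n (cis t)) \<partial>circle_measure) = ennreal (\<integral>t. B - g n (cis t) \<partial>circle_measure)"
      by (rule nn_integral_eq_integral[OF int']) (use gB in auto)
    also have "(\<integral>t. B - g n (cis t) \<partial>circle_measure) = B - (\<integral>t. g n (cis t) \<partial>circle_measure)"
      by (subst Bochner_Integration.integral_diff) (auto simp: int measure_circle_measure_UNIV finite_measure.integrable_const)
    finally have "(\<integral>t. g n (cis t) \<partial>circle_measure) < m"
      using n False by (auto simp: ennreal_less_iff)
    then show ?thesis by (intro that[of "g n"]) (use cont gk in auto)
  qed
qed

section \<open>Logarithms of homogeneous functions on a disc\<close>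

text \<open>Real parts of polynomials are trigonometric polynomials on the circle. They form an algebra there
  because \<open>cnj z = 1/z\<close> turns \<open>z\<^sup>n cnj(z)\<^sup>m\<close> into a power of \<open>z\<close> or of \<open>cnj z\<close>; the Stone-Weierstrass
  theorem does the rest. The approximants extend harmonically to the disc, which replaces the
  solution of the Dirichlet problem.\<close>

lemma Re_polynomial_approximation:
  fixes g :: "complex \<Rightarrow> real"
  assumes g: "continuous_on (sphere 0 1) g" and e: "e > 0"
  obtains p where "\<And>z. z \<in> sphere 0 1 \<Longrightarrow> \<bar>g z - Re (poly p z)\<bar> < e"
proof -
  let ?S = "sphere (0::complex) 1"
  define R where "R = {f. \<exists>p. \<forall>z\<in>?S. f z = Re (poly p z)}"
  have add: "(\<lambda>x. f x + h x) \<in> R" if "f \<in> R" "h \<in> R" for f h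
  proof -
    from that obtain p q where "\<forall>z\<in>?S. f z = Re (poly p z)" "\<forall>z\<in>?S. h z = Re (poly q z)"
      by (auto simp: R_def)
    then have "\<forall>z\<in>?S. f z + h z = Re (poly (p + q) z)" by simp
    then show ?thesis unfolding R_def by blast
  qed
  have sum: "(\<lambda>x. \<Sum>i\<in>I. f i x) \<in> R" if "finite I" "\<And>i. i \<in> I \<Longrightarrow> f i \<in> R" for I :: "nat set" and f
    using that
  proof (induction I rule: finite_induct)
    case empty
    have "\<forall>z\<in>?S. (0::real) = Re (poly 0 z)" by simp
    then show ?case unfolding R_def by (auto intro: exI[of _ 0])
  next
    case (insert i I)
    then show ?case using add[of "f i" "\<lambda>x. \<Sum>i\<in>I. f i x"] by simp
  qed
  have monom: "(\<lambda>z. Re (c * z ^ n)) \<in> R" for c n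
    unfolding R_def by (auto intro!: exI[of _ "monom c n"] simp: poly_monom)
  have mixed: "(\<lambda>z. Re (c * z ^ n * cnj (a * z ^ m))) \<in> R" for c n a m
  proof -
    have "Re (c * z ^ n * cnj (a * z ^ m)) =
        (if m \<le> n then Re (c * cnj a * z ^ (n - m)) else Re (cnj c * a * z ^ (m - n)))" if z: "z \<in> ?S" for z
    proof -
      have zz: "z ^ j * cnj z ^ j = 1" for j
        using z complex_norm_square[of z] by (simp flip: power_mult_distrib)
      show ?thesis
      proof (cases "m \<le> n")
        case True
        have "z ^ n = z ^ (n - m) * z ^ m" using True by (simp flip: power_add)
        then have "c * z ^ n * cnj (a * z ^ m) = c * cnj a * z ^ (n - m) * (z ^ m * cnj z ^ m)"
          by (simp add: mult_ac)
        then show ?thesis using True by (simp only: zz mult_1_right if_True)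
      next
        case False
        have "cnj z ^ m = cnj z ^ (m - n) * cnj z ^ n" using False by (simp flip: power_add)
        then have "c * z ^ n * cnj (a * z ^ m) = c * cnj a * cnj z ^ (m - n) * (z ^ n * cnj z ^ n)"
          by (simp add: mult_ac)
        also have "\<dots> = cnj (cnj c * a * z ^ (m - n))" by (simp add: zz)
        finally show ?thesis using False by (simp only: complex_cnj cnj.sel if_False)
      qed
    qed
    moreover have "(\<lambda>z. if m \<le> n then Re (c * cnj a * z ^ (n - m)) else Re (cnj c * a * z ^ (m - n))) \<in> R"
      by (cases "m \<le> n") (simp_all only: if_True if_False monom)
    ultimately show ?thesis unfolding R_def by auto
  qed
  have prod_monom: "(\<lambda>z. Re (c * z ^ n) * Re (a * z ^ m)) \<in> R" for c n a m
  proof -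
    have polar: "Re u * Re v = Re ((u / 2) * v) + Re ((u / 2) * cnj v)" for u v :: complex
      by (simp add: field_simps)
    have "(\<lambda>z. Re (c * z ^ n) * Re (a * z ^ m)) =
      (\<lambda>z. Re ((c * a / 2) * z ^ (n + m)) + Re ((c / 2) * z ^ n * cnj (a * z ^ m)))"
    proof
      fix z
      have "(c * z ^ n / 2) * (a * z ^ m) = (c * a / 2) * z ^ (n + m)" by (simp add: power_add)
      moreover have "(c * z ^ n / 2) * cnj (a * z ^ m) = (c / 2) * z ^ n * cnj (a * z ^ m)" by simp
      ultimately show "Re (c * z ^ n) * Re (a * z ^ m) =
          Re ((c * a / 2) * z ^ (n + m)) + Re ((c / 2) * z ^ n * cnj (a * z ^ m))"
        using polar[of "c * z ^ n" "a * z ^ m"] by (simp only:)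
    qed
    then show ?thesis using add[OF monom mixed] by (simp only:)
  qed
  have mult: "(\<lambda>x. f x * h x) \<in> R" if "f \<in> R" "h \<in> R" for f h
  proof -
    from that obtain p q where pq: "\<forall>z\<in>?S. f z = Re (poly p z)" "\<forall>z\<in>?S. h z = Re (poly q z)"
      by (auto simp: R_def)
    have "f z * h z = (\<Sum>i\<le>degree p. \<Sum>j\<le>degree q. Re (coeff p i * z ^ i) * Re (coeff q j * z ^ j))" if "z \<in> ?S" for z
      using pq that by (simp add: poly_altdef sum_product)
    moreover have "(\<lambda>z. \<Sum>i\<le>degree p. \<Sum>j\<le>degree q. Re (coeff p i * z ^ i) * Re (coeff q j * z ^ j)) \<in> R"
      by (intro sum prod_monom) auto
    ultimately show ?thesis unfolding R_def by auto
  qed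
  interpret function_ring_on R ?S
  proof
    show "compact ?S" by simp
    show "continuous_on ?S f" if "f \<in> R" for f
    proof -
      from that obtain p where p: "\<forall>z\<in>?S. f z = Re (poly p z)" by (auto simp: R_def)
      have "continuous_on ?S (\<lambda>z. Re (poly p z))" by (intro continuous_intros)
      then show ?thesis by (rule continuous_on_eq) (use p in simp)
    qed
    show "(\<lambda>_. c) \<in> R" for c
      unfolding R_def by (auto intro!: exI[of _ "[:of_real c:]"])
    show "\<exists>f\<in>R. f x \<noteq> f y" if "x \<in> ?S" "y \<in> ?S" "x \<noteq> y" for x y
    proof (cases "Re x = Re y")
      case True
      then have "Re (- \<i> * x ^ 1) \<noteq> Re (- \<i> * y ^ 1)" using that(3) by (simp add: complex_eq_iff)
      then show ?thesis by (intro bexI[OF _ monom[of "- \<i>" 1]])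
    next
      case False
      then have "Re (1 * x ^ 1) \<noteq> Re (1 * y ^ 1)" by simp
      then show ?thesis by (intro bexI[OF _ monom[of 1 1]])
    qed
  qed (fact add mult)+
  obtain h where "h \<in> R" "\<forall>x\<in>?S. \<bar>g x - h x\<bar> < e"
    using Stone_Weierstrass_basic[OF g e] by blast
  then show ?thesis using that unfolding R_def by fastforce
qed

text \<open>A failure of the mean value inequality at the centre produces a strictly superharmonic function
  touching \<open>k\<close> from above inside the disc: subtract from \<open>k\<close> a harmonic polynomial that dominates it on
  the circle and lies below it at the centre. Adding \<open>\<epsilon> \<bar>\<zeta>\<bar>\<^sup>2\<close> with \<open>2\<epsilon>\<close> equal to the gap at the centre
  raises the boundary values to at most \<open>\<epsilon>\<close>, so the maximum is still taken in the interior.\<close>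

lemma interior_touching:
  fixes k :: "complex \<Rightarrow> ereal"
  assumes usc: "\<And>c. openin (top_of_set (cball 0 1)) {z\<in>cball 0 1. k z < c}"
    and fin: "\<And>z. z \<in> cball 0 1 \<Longrightarrow> k z < \<infinity>"
    and meas: "(\<lambda>t. k (cis t)) \<in> borel_measurable borel"
    and m: "ereal_integral circle_measure (\<lambda>t. k (cis t)) < k 0"
  obtains p \<epsilon> b where "\<epsilon> > 0" "cmod b < 1" "k b = ereal (Re (poly p b) - \<epsilon> * (cmod b)\<^sup>2)"
    "\<And>z. z \<in> cball 0 1 \<Longrightarrow> k z \<le> ereal (Re (poly p z) - \<epsilon> * (cmod z)\<^sup>2)"
proof -
  let ?K = "cball (0::complex) 1" and ?S = "sphere (0::complex) 1"
  have S: "?S \<subseteq> ?K" by auto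
  obtain k0 where k0: "k 0 = ereal k0" using m fin[of 0] by (cases "k 0") auto
  have usc': "openin (top_of_set ?S) {z\<in>?S. k z < c}" for c
  proof -
    obtain T where T: "open T" "{z\<in>?K. k z < c} = ?K \<inter> T"
      using usc[of c] by (auto simp: openin_open)
    have "{z\<in>?S. k z < c} = ?S \<inter> {z\<in>?K. k z < c}" using S by auto
    also have "\<dots> = ?S \<inter> T" unfolding T(2) using S by auto
    finally show ?thesis using T(1) by (auto simp: openin_open)
  qed
  obtain g where g: "continuous_on UNIV g" "\<And>z. z \<in> ?S \<Longrightarrow> k z \<le> ereal (g z)" 
      "(\<integral>t. g (cis t) \<partial>circle_measure) < k0"
    using usc_continuous_majorant[OF usc' _ meas m[unfolded k0]] fin S by blast
  define \<delta> where "\<delta> = (k0 - (\<integral>t. g (cis t) \<partial>circle_measure)) / 4"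
  have \<delta>: "\<delta> > 0" using g(3) by (simp add: \<delta>_def)
  obtain p0 where p0: "\<And>z. z \<in> ?S \<Longrightarrow> \<bar>g z - Re (poly p0 z)\<bar> < \<delta>"
    using Re_polynomial_approximation[OF continuous_on_subset[OF g(1)] \<delta>] by (metis subset_UNIV)
  \<comment> \<open>raised by \<open>\<delta>\<close>, the approximation of \<open>g\<close> lies above \<open>k\<close> on the circle\<close>
  define p1 where "p1 = p0 + [:of_real \<delta>:]"
  have p1: "g z \<le> Re (poly p1 z)" "Re (poly p1 z) \<le> g z + 2 * \<delta>" if "z \<in> ?S" for z
    using p0[OF that] by (auto simp: p1_def abs_less_iff)
  have bd: "\<exists>B. \<forall>t. \<bar>f (cis t)\<bar> \<le> B" if "continuous_on UNIV f" for f :: "complex \<Rightarrow> real"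
  proof -
    have "bounded (f ` ?S)"
      by (intro compact_imp_bounded compact_continuous_image continuous_on_subset[OF that]) auto
    then show ?thesis by (fastforce simp: bounded_iff)
  qed
  have int: "integrable circle_measure (\<lambda>t. f (cis t))" if c: "continuous_on UNIV f" for f :: "complex \<Rightarrow> real"
  proof -
    obtain B where B: "\<And>t. \<bar>f (cis t)\<bar> \<le> B" using bd[OF c] by blast
    show ?thesis by (rule integrable_circle_continuous[OF _ B])
      (rule continuous_on_compose2[OF c], auto intro!: continuous_intros)
  qed
  have intp: "integrable circle_measure (\<lambda>t. Re (poly p1 (cis t)))"
    by (rule int[of "\<lambda>z. Re (poly p1 z)"]) (intro continuous_intros)
  have "Re (poly p1 0) = (\<integral>t. Re (poly p1 (cis t)) \<partial>circle_measure)"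
    by (rule circle_mean_Re_holomorphic[of _ 2, symmetric]) (auto intro!: holomorphic_intros)
  also have "\<dots> \<le> (\<integral>t. g (cis t) + 2 * \<delta> \<partial>circle_measure)"
    by (rule integral_mono[OF intp]) 
      (use p1(2) in \<open>auto intro!: Bochner_Integration.integrable_add int[OF g(1)] finite_measure.integrable_const\<close>)
  also have "\<dots> = (\<integral>t. g (cis t) \<partial>circle_measure) + 2 * \<delta>"
    by (subst Bochner_Integration.integral_add)
      (auto simp: measure_circle_measure_UNIV intro!: int[OF g(1)] finite_measure.integrable_const)
  also have "\<dots> = k0 - 2 * \<delta>"
  proof -
    have "4 * \<delta> = k0 - (\<integral>t. g (cis t) \<partial>circle_measure)" by (simp add: \<delta>_def)
    then show ?thesis by linarith
  qed
  finally have p10: "Re (poly p1 0) < k0" using \<delta> by simp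
  define \<epsilon> where "\<epsilon> = (k0 - Re (poly p1 0)) / 2"
  have \<epsilon>: "\<epsilon> > 0" using p10 by (simp add: \<epsilon>_def)
  define \<phi> where "\<phi> z = Re (poly p1 z) - \<epsilon> * (cmod z)\<^sup>2" for z
  have \<phi>c: "continuous_on ?K \<phi>" unfolding \<phi>_def by (intro continuous_intros)
  define v where "v z = k z - ereal (\<phi> z)" for z
  have "openin (top_of_set ?K) {z\<in>?K. v z < c}" for c
  proof (cases c)
    case PInf
    then have "{z\<in>?K. v z < c} = ?K" using fin by (auto simp: v_def less_top[symmetric] ereal_minus_eq_PInfty_iff)
    then show ?thesis by (metis openin_subtopology_self topspace_euclidean_subtopology openin_topspace)
  next
    case MInf
    then have "{z\<in>?K. v z < c} = {}" by auto
    then show ?thesis by (simp only: openin_empty)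
  next
    case (real x)
    \<comment> \<open>the sublevel set of the difference is a union of intersections of relatively open sets\<close>
    have "v z < c \<longleftrightarrow> (\<exists>r. k z < ereal r \<and> r < x + \<phi> z)" if "z \<in> ?K" for z
    proof
      assume "v z < c"
      then have "k z < ereal (x + \<phi> z)" by (cases "k z") (auto simp: v_def real)
      then obtain r where "k z < ereal r" "ereal r < ereal (x + \<phi> z)" using ereal_dense2 by blast
      then show "\<exists>r. k z < ereal r \<and> r < x + \<phi> z" by auto
    next
      assume "\<exists>r. k z < ereal r \<and> r < x + \<phi> z"
      then show "v z < c" by (cases "k z") (auto simp: v_def real)
    qed
    then have "{z\<in>?K. v z < c} = (\<Union>r. {z\<in>?K. k z < ereal r} \<inter> {z\<in>?K. r < x + \<phi> z})" by auto
    moreover have "openin (top_of_set ?K) {z\<in>?K. r < x + \<phi> z}" for r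
    proof -
      have "continuous_on ?K (\<lambda>z. x + \<phi> z)" by (intro continuous_intros \<phi>c)
      then have "openin (top_of_set ?K) (?K \<inter> (\<lambda>z. x + \<phi> z) -` {r<..})"
        by (rule continuous_openin_preimage_gen) simp
      moreover have "?K \<inter> (\<lambda>z. x + \<phi> z) -` {r<..} = {z\<in>?K. r < x + \<phi> z}" by auto
      ultimately show ?thesis by simp
    qed
    ultimately show ?thesis using usc by (auto intro!: openin_Union openin_Int)
  qed
  then obtain b where b: "b \<in> ?K" "\<And>z. z \<in> ?K \<Longrightarrow> v z \<le> v b"
    using usc_attains_max[OF compact_cball, of 0 1 v] by (metis cball_eq_empty not_one_less_zero)
  have "v 0 = ereal (2 * \<epsilon>)" by (simp add: v_def k0 \<phi>_def \<epsilon>_def)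
  then have vb: "ereal (2 * \<epsilon>) \<le> v b" using b(2)[of 0] by simp
  obtain kb where kb: "k b = ereal kb" using vb fin[OF b(1)] by (cases "k b") (auto simp: v_def)
  define c where "c = kb - \<phi> b"
  have vc: "v b = ereal c" by (simp add: v_def kb c_def)
  have "cmod b \<noteq> 1"
  proof
    assume 1: "cmod b = 1"
    have "k b \<le> ereal (g b)" using g(2)[of b] 1 by simp
    moreover have "g b \<le> Re (poly p1 b)" using p1(1)[of b] 1 by simp
    ultimately have "c \<le> \<epsilon>" by (simp add: c_def kb \<phi>_def 1)
    then show False using vb vc \<epsilon> by simp
  qed
  then have b1: "cmod b < 1" using b(1) by simp
  show ?thesis
  proof (rule that[of \<epsilon> b "p1 + [:of_real c:]"])
    show "k b = ereal (Re (poly (p1 + [:of_real c:]) b) - \<epsilon> * (cmod b)\<^sup>2)"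
      by (simp add: kb c_def \<phi>_def)
    fix z assume z: "z \<in> ?K"
    have "k z \<le> ereal (c + \<phi> z)" using b(2)[OF z] unfolding vc by (cases "k z") (auto simp: v_def)
    then show "k z \<le> ereal (Re (poly (p1 + [:of_real c:]) z) - \<epsilon> * (cmod z)\<^sup>2)"
      by (simp add: \<phi>_def add_ac add_diff_eq)
  qed (fact \<epsilon> b1)+
qed

lemma holomorphic_double_zero_bound:
  assumes G: "G holomorphic_on ball 0 R" and R: "R > 0" and G0: "G 0 = 0" "deriv G 0 = 0"
  obtains K where "K \<ge> 0" "\<And>z. cmod z \<le> R / 2 \<Longrightarrow> cmod (G z) \<le> K * (cmod z)\<^sup>2"
proof -
  let ?S = "cball (0::complex) (R / 2)"
  have S: "?S \<subseteq> ball 0 R" using R by auto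
  have G1: "deriv G holomorphic_on ball 0 R" by (rule holomorphic_deriv[OF G open_ball])
  have G2: "deriv (deriv G) holomorphic_on ball 0 R" by (rule holomorphic_deriv[OF G1 open_ball])
  have "bounded (deriv (deriv G) ` ?S)"
    by (intro compact_imp_bounded compact_continuous_image compact_cball holomorphic_on_imp_continuous_on
        holomorphic_on_subset[OF G2 S])
  then obtain B where B: "\<And>z. z \<in> ?S \<Longrightarrow> cmod (deriv (deriv G) z) \<le> B"
    unfolding bounded_iff by blast
  have B0: "B \<ge> 0" using order_trans[OF norm_ge_zero B[of 0]] R by simp
  show ?thesis
  proof (rule that[OF B0])
    fix z assume "cmod z \<le> R / 2"
    then have z: "z \<in> ?S" by simp
    define f where "f i = (deriv ^^ i) G" for i
    have "cmod (f 0 z - (\<Sum>i\<le>1. f i 0 * (z - 0) ^ i / fact i)) \<le> B * cmod (z - 0) ^ Suc 1 / fact 1"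
    proof (rule complex_Taylor[of ?S])
      fix i x assume x: "x \<in> ?S" and "i \<le> (1::nat)"
      then have "i = 0 \<or> i = 1" by auto
      then have "f i holomorphic_on ball 0 R" using G G1 by (auto simp: f_def)
      then have "(f i has_field_derivative deriv (f i) x) (at x)"
        by (rule holomorphic_derivI) (use x S in auto)
      then show "(f i has_field_derivative f (Suc i) x) (at x within ?S)"
        by (simp add: f_def has_field_derivative_at_within)
    next
      fix x assume "x \<in> ?S"
      then show "cmod (f (Suc 1) x) \<le> B" using B by (simp add: f_def)
    qed (use R z in auto)
    then show "cmod (G z) \<le> B * (cmod z)\<^sup>2"
      using G0 by (simp add: f_def power2_eq_square)
  qed
qed

lemma exp_le_quadratic:
  fixes x :: real
  assumes "\<bar>x\<bar> \<le> 1"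
  shows "exp x \<le> 1 + x + x\<^sup>2"
proof (cases "x \<ge> 0")
  case True
  then show ?thesis using exp_bound[of x] assms by simp
next
  case False
  define y where "y = - x"
  have y: "y > 0" "y \<le> 1" using False assms by (auto simp: y_def)
  have e: "1 + y + y\<^sup>2 / 2 \<le> exp y" by (rule exp_lower_Taylor_quadratic) (use y in simp)
  have nn: "0 \<le> 1 - y + y\<^sup>2" using y by (simp add: add_nonneg_nonneg)
  have "1 \<le> 1 + y\<^sup>2 / 2 + y ^ 3 / 2 + y ^ 4 / 2" using y by simp
  also have "\<dots> = (1 - y + y\<^sup>2) * (1 + y + y\<^sup>2 / 2)" by (simp add: field_simps power_numeral_reduce)
  also have "\<dots> \<le> (1 - y + y\<^sup>2) * exp y" by (intro mult_left_mono e nn)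
  finally show ?thesis by (simp add: y_def exp_minus field_simps)
qed

text \<open>The function \<open>\<bar>1 + s(\<zeta> - b)\<bar>\<^sup>d exp (d (Re p(\<zeta>) - \<epsilon> \<bar>\<zeta>\<bar>\<^sup>2))\<close> equals, on the circle \<open>\<zeta> = b + z\<close>, \<open>\<bar>z\<bar> = r\<close>,
  its value at \<open>b\<close> times \<open>exp (d Re G(z)) exp (- d \<epsilon> r\<^sup>2)\<close> with a holomorphic \<open>G\<close> vanishing at the
  origin. The parameter \<open>s\<close> is chosen to give \<open>G\<close> a double zero. As \<open>Re G\<close> has mean \<open>0\<close>, the mean of
  \<open>exp (d Re G)\<close> is then \<open>1 + O(r\<^sup>4)\<close>, which cannot make up for the factor \<open>exp (- d \<epsilon> r\<^sup>2)\<close>.\<close>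

lemma affine_factor_strict_supermean:
  fixes p :: "complex poly"
  assumes d: "d > 0" and \<epsilon>: "\<epsilon> > 0"
  shows "\<exists>s. \<exists>r0::real. r0 > 0 \<and> (\<forall>r::real. 0 < r \<and> r < r0 \<longrightarrow>
    ereal_integral circle_measure (\<lambda>t. ereal (cmod (1 + s * complex_of_real r * cis t) powr d *
      exp (d * (Re (poly p (b + complex_of_real r * cis t)) - \<epsilon> * (cmod (b + complex_of_real r * cis t))\<^sup>2))))
    < ereal (exp (d * (Re (poly p b) - \<epsilon> * (cmod b)\<^sup>2))))"
proof -
  define s where "s = 2 * \<epsilon> * cnj b - poly (pderiv p) b"
  define R where "R = 1 / (cmod s + 1)"
  have R: "R > 0" by (simp add: R_def add_nonneg_pos)
  have sR: "cmod (s * z) < 1" if "cmod z < R" for z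
  proof -
    have "cmod s * cmod z \<le> (cmod s + 1) * cmod z" by (intro mult_right_mono) auto
    also have "\<dots> < (cmod s + 1) * R" by (intro mult_strict_left_mono that) (simp add: add_nonneg_pos)
    also have "\<dots> = 1" by (simp add: R_def add_nonneg_eq_0_iff)
    finally show ?thesis by (simp add: norm_mult)
  qed
  have pos: "0 < 1 + Re (s * z)" if "cmod z < R" for z
    using sR[OF that] abs_Re_le_cmod[of "s * z"] by linarith
  have np: "1 + s * z \<notin> \<real>\<^sub>\<le>\<^sub>0" "1 + s * z \<noteq> 0" if "cmod z < R" for z
  proof -
    have "Re (1 + s * z) > 0" using pos[OF that] by (metis plus_complex.sel(1) one_complex.sel(1))
    then show "1 + s * z \<notin> \<real>\<^sub>\<le>\<^sub>0" "1 + s * z \<noteq> 0"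
      by (auto simp only: complex_nonpos_Reals_iff zero_complex.sel)
  qed
  define G where "G z = poly p (b + z) - poly p b - 2 * \<epsilon> * cnj b * z + Ln (1 + s * z)" for z
  have hol: "G holomorphic_on ball 0 R"
    unfolding G_def by (intro holomorphic_intros) (use np in auto)
  have "(G has_field_derivative poly (pderiv p) (b + 0) * (0 + 1) - 0 - 2 * \<epsilon> * cnj b * 1 + inverse (1 + s * 0) * (0 + s * 1)) (at 0)"
    unfolding G_def
    by (rule derivative_eq_intros refl DERIV_chain2[OF poly_DERIV] | simp)+
  then have G0: "G 0 = 0" "deriv G 0 = 0"
    by (auto simp: G_def s_def dest: DERIV_imp_deriv)
  obtain K where K: "K \<ge> 0" "\<And>z. cmod z \<le> R / 2 \<Longrightarrow> cmod (G z) \<le> K * (cmod z)\<^sup>2"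
    using holomorphic_double_zero_bound[OF hol R G0] by blast
  define E where "E = exp (d * (Re (poly p b) - \<epsilon> * (cmod b)\<^sup>2))"
  have E: "E > 0" by (simp add: E_def)
  \<comment> \<open>one constant for both smallness conditions below: \<open>d K r\<^sup>2 \<le> 1\<close> for the quadratic bound on the exponential, and \<open>d K\<^sup>2 r\<^sup>2 < \<epsilon>\<close> for the final estimate\<close>
  define M where "M = 1 + d * K + d * K\<^sup>2 / \<epsilon>"
  have M: "M \<ge> 1" "d * K \<le> M" "d * K\<^sup>2 / \<epsilon> < M" using d K(1) \<epsilon> by (auto simp: M_def add_pos_nonneg)
  define r0 where "r0 = min (R / 2) (1 / M)"
  show ?thesis
  proof (intro exI[of _ s] exI[of _ r0] conjI allI impI)
    show "r0 > 0" using R M by (simp add: r0_def)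
    fix r :: real assume "0 < r \<and> r < r0"
    then have r: "0 < r" "r < r0" by auto
    have rR: "r < R / 2" and rM: "r * M < 1" using r M by (auto simp: r0_def field_simps)
    have r1: "r \<le> 1"
    proof -
      have "r * 1 \<le> r * M" using r M by (intro mult_left_mono) auto
      then show ?thesis using rM by simp
    qed
    have r2M: "r\<^sup>2 * M < 1"
    proof -
      have "r\<^sup>2 * M = r * (r * M)" by (simp add: power2_eq_square)
      also have "\<dots> \<le> 1 * (r * M)" using r r1 M by (intro mult_right_mono) auto
      finally show ?thesis using rM by simp
    qed
    define x where "x t = d * Re (G (r * cis t))" for t
    have normr: "cmod (r * cis t) = r" for t using r by (simp add: norm_mult)
    have Gb: "cmod (G (r * cis t)) \<le> K * r\<^sup>2" for t using K(2)[of "r * cis t"] rR r by (simp add: norm_mult)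
    have xb: "\<bar>x t\<bar> \<le> d * K * r\<^sup>2" for t
    proof -
      have "\<bar>Re (G (r * cis t))\<bar> \<le> K * r\<^sup>2" using Gb[of t] abs_Re_le_cmod order_trans by blast
      then show ?thesis using d by (simp add: x_def abs_mult mult.assoc)
    qed
    have dK: "d * K * r\<^sup>2 \<le> 1"
    proof -
      have "d * K * r\<^sup>2 \<le> M * r\<^sup>2" using M by (intro mult_right_mono) auto
      then show ?thesis using r2M by (simp add: mult.commute)
    qed
    have contx: "continuous_on UNIV x" unfolding x_def
    proof (intro continuous_intros)
      show "continuous_on UNIV (\<lambda>t. G (r * cis t))"
        by (rule continuous_on_compose2[OF holomorphic_on_imp_continuous_on[OF hol]])
          (use rR r R in \<open>auto intro!: continuous_intros simp: norm_mult\<close>)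
    qed
    have intx: "integrable circle_measure x" by (rule integrable_circle_continuous[OF contx xb])
    have x0: "(\<integral>t. x t \<partial>circle_measure) = 0"
    proof -
      have "(\<lambda>z. d * G (r * z)) holomorphic_on ball 0 (R / r)"
        by (intro holomorphic_intros holomorphic_on_compose_gen[OF _ hol, unfolded o_def])
          (use r in \<open>auto simp: norm_mult field_simps\<close>)
      then have "(\<integral>t. Re (d * G (r * cis t)) \<partial>circle_measure) = Re (d * G (complex_of_real r * 0))"
        by (rule circle_mean_Re_holomorphic) (use r rR R in \<open>simp add: field_simps\<close>)
      then show ?thesis by (simp add: x_def[abs_def] G0)
    qed
    define q where "q t = cmod (1 + s * complex_of_real r * cis t) powr d *
      exp (d * (Re (poly p (b + complex_of_real r * cis t)) - \<epsilon> * (cmod (b + complex_of_real r * cis t))\<^sup>2))" for t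
    define D where "D = exp (- (d * \<epsilon> * r\<^sup>2))"
    have q: "q t = E * D * exp (x t)" for t
    proof -
      let ?z = "r * cis t"
      have zR: "cmod ?z < R" using normr[of t] rR R by simp
      have "1 + s * complex_of_real r * cis t = 1 + s * ?z" by simp
      moreover have "cmod (1 + s * ?z) powr d = exp (d * Re (Ln (1 + s * ?z)))"
        using np(2)[OF zR] by (simp add: powr_def)
      moreover have "(cmod (b + ?z))\<^sup>2 = (cmod b)\<^sup>2 + 2 * Re (cnj b * ?z) + r\<^sup>2"
      proof -
        have "(cmod (b + w))\<^sup>2 = (cmod b)\<^sup>2 + 2 * Re (cnj b * w) + (cmod w)\<^sup>2" for w
          unfolding cmod_power2 by (simp add: power2_eq_square algebra_simps)
        then show ?thesis by (simp only: normr)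
      qed
      ultimately have "q t = exp (d * Re (Ln (1 + s * ?z)) +
          d * (Re (poly p (b + ?z)) - \<epsilon> * ((cmod b)\<^sup>2 + 2 * Re (cnj b * ?z) + r\<^sup>2)))"
        by (simp only: q_def exp_add)
      also have "d * Re (Ln (1 + s * ?z)) +
          d * (Re (poly p (b + ?z)) - \<epsilon> * ((cmod b)\<^sup>2 + 2 * Re (cnj b * ?z) + r\<^sup>2)) 
          = d * (Re (poly p b) - \<epsilon> * (cmod b)\<^sup>2) + - (d * \<epsilon> * r\<^sup>2) + x t"
      proof -
        have "Re (2 * \<epsilon> * cnj b * ?z) = 2 * \<epsilon> * Re (cnj b * ?z)"
          by (simp add: algebra_simps)
        then show ?thesis
          unfolding x_def G_def plus_complex.sel minus_complex.sel by (simp only:) (simp only: algebra_simps)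
      qed
      finally show ?thesis by (simp only: E_def D_def exp_add)
    qed
    have expb: "exp (x t) \<le> 1 + x t + (d * K * r\<^sup>2)\<^sup>2" for t
    proof -
      have "exp (x t) \<le> 1 + x t + (x t)\<^sup>2" using xb[of t] dK by (intro exp_le_quadratic) simp
      also have "(x t)\<^sup>2 \<le> (d * K * r\<^sup>2)\<^sup>2" using xb[of t] by (simp add: abs_le_square_iff[symmetric])
      finally show ?thesis by simp
    qed
    have intq: "integrable circle_measure q"
    proof (rule integrable_circle_bounded)
      have "continuous_on UNIV (\<lambda>t. E * D * exp (x t))" by (intro continuous_intros contx)
      then show "q \<in> borel_measurable borel" unfolding q by (rule borel_measurable_continuous_onI)
      show "\<bar>q t\<bar> \<le> E * D * exp 1" for t
        using xb[of t] dK E unfolding q by (auto simp: D_def abs_mult)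
    qed
    have intu: "integrable circle_measure (\<lambda>t. 1 + x t + (d * K * r\<^sup>2)\<^sup>2)"
      by (intro Bochner_Integration.integrable_add intx finite_measure.integrable_const) auto
    have "(\<integral>t. q t \<partial>circle_measure) \<le> (\<integral>t. E * D * (1 + x t + (d * K * r\<^sup>2)\<^sup>2) \<partial>circle_measure)"
      by (intro integral_mono intq Bochner_Integration.integrable_mult_right intu)
        (use expb E in \<open>auto simp: q D_def\<close>)
    also have "\<dots> = E * D * (1 + (d * K * r\<^sup>2)\<^sup>2)"
    proof -
      have "(\<integral>t. 1 + x t + (d * K * r\<^sup>2)\<^sup>2 \<partial>circle_measure) = 1 + (\<integral>t. x t \<partial>circle_measure) + (d * K * r\<^sup>2)\<^sup>2"
        by (subst Bochner_Integration.integral_add Bochner_Integration.integral_add,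
            (intro Bochner_Integration.integrable_add intx finite_measure.integrable_const; simp)+)+
          (simp add: measure_circle_measure_UNIV)
      then show ?thesis by (simp add: x0)
    qed
    also have "\<dots> < E"
    proof -
      have "(d * K * r\<^sup>2)\<^sup>2 = (d * r\<^sup>2) * (d * K\<^sup>2 * r\<^sup>2)" by (simp add: power2_eq_square)
      also have "\<dots> < (d * r\<^sup>2) * \<epsilon>"
      proof (intro mult_strict_left_mono)
        have "d * K\<^sup>2 / \<epsilon> * r\<^sup>2 < M * r\<^sup>2" using M r by (intro mult_strict_right_mono) auto
        then have "d * K\<^sup>2 / \<epsilon> * r\<^sup>2 < 1" using r2M by (simp add: mult.commute)
        then show "d * K\<^sup>2 * r\<^sup>2 < \<epsilon>" using \<epsilon> by (simp add: field_simps)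
      qed (use d r in simp)
      finally have "1 + (d * K * r\<^sup>2)\<^sup>2 < 1 + d * \<epsilon> * r\<^sup>2" by (simp add: mult_ac)
      also have "\<dots> \<le> exp (d * \<epsilon> * r\<^sup>2)" by (rule exp_ge_add_one_self)
      finally have "D * (1 + (d * K * r\<^sup>2)\<^sup>2) < D * exp (d * \<epsilon> * r\<^sup>2)"
        by (intro mult_strict_left_mono) (simp_all add: D_def)
      also have "\<dots> = 1" by (simp add: D_def flip: exp_add)
      finally have "E * (D * (1 + (d * K * r\<^sup>2)\<^sup>2)) < E * 1"
        using E by (intro mult_strict_left_mono)
      then show ?thesis by (simp add: mult.assoc)
    qed
    finally have "(\<integral>t. q t \<partial>circle_measure) < E" .
    then show "ereal_integral circle_measure (\<lambda>t. ereal (cmod (1 + s * complex_of_real r * cis t) powr d *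
      exp (d * (Re (poly p (b + complex_of_real r * cis t)) - \<epsilon> * (cmod (b + complex_of_real r * cis t))\<^sup>2))))
    < ereal (exp (d * (Re (poly p b) - \<epsilon> * (cmod b)\<^sup>2)))"
      using ereal_integral_real[OF intq] by (simp add: q_def[abs_def] E_def)
  qed
qed

lemma exp_ereal_simps [simp]: "exp_ereal (ereal x) = ereal (exp x)" "exp_ereal (-\<infinity>) = 0" "exp_ereal \<infinity> = \<infinity>"
  by (auto simp: exp_ereal_def)

lemma exp_ereal_nonneg [simp]: "0 \<le> exp_ereal x"
  by (cases x) auto

lemma exp_ereal_mono: "x \<le> y \<Longrightarrow> exp_ereal x \<le> exp_ereal y"
  by (cases x; cases y) auto

lemma exp_ereal_less_iff [simp]: "exp_ereal x < exp_ereal y \<longleftrightarrow> x < y"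
  by (cases x; cases y) auto

lemma exp_ereal_inject [simp]: "exp_ereal x = exp_ereal y \<longleftrightarrow> x = y"
  using exp_ereal_less_iff by (metis less_irrefl linorder_neqE)

lemma ereal_times_left_cancel:
  assumes "d > 0"
  shows "ereal d * x = ereal d * y \<longleftrightarrow> x = y"
  using assms by (cases x; cases y) auto

text \<open>Local form of the passage from homogeneous plurisubharmonic functions to weights: the mean value
  inequality for \<open>\<bar>1 + s\<zeta>\<bar>\<^sup>d exp (d k)\<close> on small discs, for all \<open>s\<close>, yields the one for \<open>k\<close> on the unit disc.\<close>

lemma log_subharmonic:
  fixes k :: "complex \<Rightarrow> ereal"
  assumes usc: "\<And>c. openin (top_of_set (cball 0 1)) {z\<in>cball 0 1. k z < c}"
    and fin: "\<And>z. z \<in> cball 0 1 \<Longrightarrow> k z < \<infinity>"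
    and meas: "(\<lambda>t. k (cis t)) \<in> borel_measurable borel"
    and d: "d > 0"
    and sub: "\<And>b s r. r > 0 \<Longrightarrow> cmod b + r \<le> 1 \<Longrightarrow> exp_ereal (ereal d * k b) \<le>
      ereal_integral circle_measure (\<lambda>t. ereal (cmod (1 + s * complex_of_real r * cis t) powr d)
         * exp_ereal (ereal d * k (b + complex_of_real r * cis t)))"
  shows "k 0 \<le> ereal_integral circle_measure (\<lambda>t. k (cis t))"
proof (rule ccontr)
  assume "\<not> ?thesis"
  then have "ereal_integral circle_measure (\<lambda>t. k (cis t)) < k 0" by simp
  then obtain p \<epsilon> b where \<epsilon>: "\<epsilon> > 0" and b: "cmod b < 1" and kb: "k b = ereal (Re (poly p b) - \<epsilon> * (cmod b)\<^sup>2)"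
    and le: "\<And>z. z \<in> cball 0 1 \<Longrightarrow> k z \<le> ereal (Re (poly p z) - \<epsilon> * (cmod z)\<^sup>2)"
    using interior_touching[OF usc fin meas] by metis
  obtain s :: complex and r0 :: real where r0: "r0 > 0" and sup: "\<forall>r::real. 0 < r \<and> r < r0 \<longrightarrow>
    ereal_integral circle_measure (\<lambda>t. ereal (cmod (1 + s * complex_of_real r * cis t) powr d *
      exp (d * (Re (poly p (b + complex_of_real r * cis t)) - \<epsilon> * (cmod (b + complex_of_real r * cis t))\<^sup>2))))
    < ereal (exp (d * (Re (poly p b) - \<epsilon> * (cmod b)\<^sup>2)))"
    using affine_factor_strict_supermean[OF d \<epsilon>, where b = b and p = p] by blast
  define r where "r = min (r0 / 2) (1 - cmod b)"
  have r: "r > 0" "r < r0" "cmod b + r \<le> 1" using r0 b by (auto simp: r_def)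
  have "exp_ereal (ereal d * k b) \<le>
      ereal_integral circle_measure (\<lambda>t. ereal (cmod (1 + s * complex_of_real r * cis t) powr d)
         * exp_ereal (ereal d * k (b + complex_of_real r * cis t)))"
    by (rule sub[OF r(1,3)])
  also have "\<dots> \<le> ereal_integral circle_measure (\<lambda>t. ereal (cmod (1 + s * complex_of_real r * cis t) powr d *
      exp (d * (Re (poly p (b + complex_of_real r * cis t)) - \<epsilon> * (cmod (b + complex_of_real r * cis t))\<^sup>2))))"
  proof (rule ereal_integral_mono)
    fix t
    let ?z = "b + complex_of_real r * cis t"
    have "cmod ?z \<le> 1" using norm_triangle_ineq[of b "complex_of_real r * cis t"] r by (simp add: norm_mult)
    then have "k ?z \<le> ereal (Re (poly p ?z) - \<epsilon> * (cmod ?z)\<^sup>2)" by (intro le) simp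
    then have "ereal d * k ?z \<le> ereal d * ereal (Re (poly p ?z) - \<epsilon> * (cmod ?z)\<^sup>2)"
      using d by (intro ereal_mult_left_mono) auto
    then have "exp_ereal (ereal d * k ?z) \<le> ereal (exp (d * (Re (poly p ?z) - \<epsilon> * (cmod ?z)\<^sup>2)))"
      using exp_ereal_mono by fastforce
    then have "ereal (cmod (1 + s * complex_of_real r * cis t) powr d) * exp_ereal (ereal d * k ?z) \<le>
       ereal (cmod (1 + s * complex_of_real r * cis t) powr d) * ereal (exp (d * (Re (poly p ?z) - \<epsilon> * (cmod ?z)\<^sup>2)))"
      by (intro ereal_mult_left_mono) auto
    then show "ereal (cmod (1 + s * complex_of_real r * cis t) powr d) * exp_ereal (ereal d * k ?z) \<le>
       ereal (cmod (1 + s * complex_of_real r * cis t) powr d * (exp (d * (Re (poly p ?z) - \<epsilon> * (cmod ?z)\<^sup>2))))"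
      by simp
  qed
  also have "\<dots> < ereal (exp (d * (Re (poly p b) - \<epsilon> * (cmod b)\<^sup>2)))" using sup r by blast
  also have "\<dots> = exp_ereal (ereal d * k b)" by (simp add: kb)
  finally show False by simp
qed

section \<open>Plurisubharmonicity of homogeneous extensions\<close>

text \<open>The affine discs of the mean value inequality are parametrized with the complex multiple \<open>*s\<close>,
  not the real one.\<close>

lemma continuous_on_scalar_smult [continuous_intros]:
  fixes w :: "complex^'n"
  assumes "continuous_on T f"
  shows "continuous_on T (\<lambda>x. f x *s w)"
  unfolding vector_scalar_mult_def
  by (intro continuous_on_vec_lambda continuous_intros assms)

lemma norm_complex_smult:
  fixes w :: "complex^'n"
  shows "norm (c *s w) = cmod c * norm w"
  unfolding norm_vec_def by (simp add: norm_mult L2_set_right_distrib)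

lemma usc_compose_continuous:
  assumes usc: "openin (top_of_set S) {z\<in>S. u z < c}"
    and f: "continuous_on T f" "f ` T \<subseteq> S"
  shows "openin (top_of_set T) {x\<in>T. u (f x) < c}"
proof -
  obtain W where W: "open W" "{z\<in>S. u z < c} = S \<inter> W"
    using usc by (auto simp: openin_open)
  have "{x\<in>T. u (f x) < c} = T \<inter> f -` W"
    using W(2) f(2) by auto
  then show ?thesis using continuous_openin_preimage_gen[OF f(1) W(1)] by simp
qed

lemma circle_in_disc:
  assumes "\<forall>\<zeta>\<in>cball 0 1. a + \<zeta> *s w \<in> S"
  shows "a + cis t *s w \<in> S"
  using assms by auto

lemma usc_circle_measurable:
  fixes u :: "complex^'n \<Rightarrow> ereal"
  assumes usc: "\<And>c. openin (top_of_set S) {z\<in>S. u z < c}"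
    and disc: "\<forall>\<zeta>\<in>cball 0 1. a + \<zeta> *s w \<in> S"
  shows "(\<lambda>t. u (a + cis t *s w)) \<in> borel_measurable borel"
proof (rule borel_measurableI_less)
  fix c
  have "openin (top_of_set UNIV) {t\<in>UNIV. u (a + cis t *s w) < c}"
    by (rule usc_compose_continuous[OF usc])
      (use circle_in_disc[OF disc] in \<open>auto intro!: continuous_intros\<close>)
  then show "{t \<in> space borel. u (a + cis t *s w) < c} \<in> sets borel" by simp
qed

lemma usc_circle_bounded_above:
  fixes u :: "complex^'n \<Rightarrow> ereal"
  assumes usc: "\<And>c. openin (top_of_set S) {z\<in>S. u z < c}"
    and fin: "\<And>z. z \<in> S \<Longrightarrow> u z < \<infinity>"
    and disc: "\<forall>\<zeta>\<in>cball 0 1. a + \<zeta> *s w \<in> S"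
  obtains B where "B \<ge> 0" "\<And>t. u (a + cis t *s w) \<le> ereal B"
proof -
  let ?S = "sphere (0::complex) 1"
  have "openin (top_of_set ?S) {\<zeta>\<in>?S. u (a + \<zeta> *s w) < c}" for c
    by (rule usc_compose_continuous[OF usc]) (use disc in \<open>auto intro!: continuous_intros\<close>)
  moreover have "?S \<noteq> {}" by simp
  ultimately obtain b where b: "b \<in> ?S" "\<And>\<zeta>. \<zeta> \<in> ?S \<Longrightarrow> u (a + \<zeta> *s w) \<le> u (a + b *s w)"
    using usc_attains_max[OF compact_sphere, where v = "\<lambda>\<zeta>. u (a + \<zeta> *s w)"] by blast
  have fb: "u (a + b *s w) < \<infinity>" using b(1) disc by (intro fin) auto
  show ?thesis
  proof (rule that[of "max 0 (real_of_ereal (u (a + b *s w)))"])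
    fix t
    have "u (a + cis t *s w) \<le> u (a + b *s w)" by (rule b(2)) simp
    also have "\<dots> \<le> ereal (max 0 (real_of_ereal (u (a + b *s w))))"
      using fb by (cases "u (a + b *s w)") auto
    finally show "u (a + cis t *s w) \<le> ereal (max 0 (real_of_ereal (u (a + b *s w))))" .
  qed simp
qed

text \<open>The index \<open>None\<close> carries the fibre coordinate, as in the charts of the total space.\<close>

definition base_part :: "complex^('n option) \<Rightarrow> complex^'n" where
  "base_part w = (\<chi> m. w $ Some m)"

definition fibre_join :: "complex \<Rightarrow> complex^'n \<Rightarrow> complex^('n option)" where
  "fibre_join t z = (\<chi> k. case k of None \<Rightarrow> t | Some m \<Rightarrow> z $ m)"

lemma fibre_join_simps [simp]:
  "fibre_join t z $ None = t" "base_part (fibre_join t z) = z"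
  by (simp_all add: fibre_join_def base_part_def vec_eq_iff)

lemma base_part_affine: "base_part (a + c *s w) = base_part a + c *s base_part w"
  by (simp add: base_part_def vec_eq_iff)

lemma fibre_join_affine: "fibre_join t z + c *s fibre_join s v = fibre_join (t + c * s) (z + c *s v)"
  by (simp add: fibre_join_def vec_eq_iff split: option.split)

lemma continuous_on_base_part [continuous_intros]: "continuous_on S base_part"
  unfolding base_part_def by (intro continuous_on_vec_lambda continuous_intros)

lemma continuous_on_fibre_join [continuous_intros]: "continuous_on S (fibre_join t)"
  unfolding fibre_join_def
proof (intro continuous_on_vec_lambda)
  fix k :: "'a option"
  show "continuous_on S (\<lambda>z. case k of None \<Rightarrow> t | Some m \<Rightarrow> z $ m)"
    by (cases k) (auto intro!: continuous_intros)
qed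

text \<open>The coordinate expression, on the total space of the dual bundle, of the function belonging to the
  weight \<open>h\<close>.\<close>

definition homogeneous_extension :: "real \<Rightarrow> (complex^'n \<Rightarrow> ereal) \<Rightarrow> complex^('n option) \<Rightarrow> ereal" where
  "homogeneous_extension d h w = ereal (cmod (w $ None) powr d) * exp_ereal (ereal d * h (base_part w))"

lemma homogeneous_extension_nonneg [simp]: "0 \<le> homogeneous_extension d h w"
  by (simp add: homogeneous_extension_def)

lemma exp_ereal_mult_less_iff:
  assumes "d > 0" "B > 0"
  shows "exp_ereal (ereal d * x) < ereal B \<longleftrightarrow> x < ereal (ln B / d)"
proof (cases x)
  case (real r)
  have "exp (d * r) < B \<longleftrightarrow> d * r < ln B" using assms(2) by (metis exp_less_cancel_iff exp_ln)
  then show ?thesis using real assms by (simp add: field_simps)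
qed (use assms in auto)

text \<open>Both factors are nonnegative and upper semicontinuous. A strict bound on their product at a point
  leaves room for raising each factor by some \<open>e > 0\<close>, also where one of them is \<open>0\<close>.\<close>

lemma usc_homogeneous_extension:
  fixes h :: "complex^'n \<Rightarrow> ereal"
  assumes usc: "\<And>c. openin (top_of_set V) {z\<in>V. h z < c}"
    and fin: "\<And>z. z \<in> V \<Longrightarrow> h z < \<infinity>" and d: "d > 0"
  shows "openin (top_of_set {w. base_part w \<in> V}) {w\<in>{w. base_part w \<in> V}. homogeneous_extension d h w < c}"
proof (subst openin_subopen, intro ballI)
  let ?S = "{w::complex^('n option). base_part w \<in> V}"
  fix w0 assume w0: "w0 \<in> {w\<in>?S. homogeneous_extension d h w < c}"
  define x0 where "x0 = cmod (w0 $ None) powr d"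
  obtain y0 where y0: "exp_ereal (ereal d * h (base_part w0)) = ereal y0" "y0 \<ge> 0"
    using w0 fin[of "base_part w0"] d by (cases "h (base_part w0)") auto
  have x0: "x0 \<ge> 0" by (simp add: x0_def)
  have lt: "ereal (x0 * y0) < c" using w0 y0 by (simp add: homogeneous_extension_def x0_def)
  obtain e where e: "e > 0" "ereal ((x0 + e) * (y0 + e)) \<le> c"
  proof (cases c)
    case (real r)
    define e where "e = min 1 ((r - x0 * y0) / (x0 + y0 + 1))"
    have "e > 0" using lt real x0 y0(2) by (simp add: e_def)
    moreover have "(x0 + e) * (y0 + e) \<le> r"
    proof -
      have "(x0 + e) * (y0 + e) = x0 * y0 + e * (x0 + y0 + e)" by (simp add: algebra_simps)
      also have "e * (x0 + y0 + e) \<le> e * (x0 + y0 + 1)"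
        using \<open>e > 0\<close> by (intro mult_left_mono) (auto simp: e_def)
      also have "\<dots> \<le> (r - x0 * y0) / (x0 + y0 + 1) * (x0 + y0 + 1)"
        using x0 y0 by (intro mult_right_mono) (auto simp: e_def)
      also have "\<dots> = r - x0 * y0" using x0 y0 by (simp add: field_simps)
      finally show ?thesis by simp
    qed
    ultimately show ?thesis using that real by simp
  next
    case PInf then show ?thesis using that[of 1] by simp
  next
    case MInf then show ?thesis using lt by simp
  qed
  let ?T1 = "{w\<in>?S. cmod (w $ None) powr d < x0 + e}"
  let ?T2 = "{w\<in>?S. h (base_part w) < ereal (ln (y0 + e) / d)}"
  have T2: "w \<in> ?T2 \<longleftrightarrow> w \<in> ?S \<and> exp_ereal (ereal d * h (base_part w)) < ereal (y0 + e)" for w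
    using exp_ereal_mult_less_iff[OF d, of "y0 + e"] y0 e by auto
  have "openin (top_of_set ?S) ?T1"
  proof -
    have "continuous_on ?S (\<lambda>w. cmod (w $ None) powr d)"
      using d by (intro continuous_on_powr' continuous_intros) auto
    from continuous_openin_preimage_gen[OF this, of "{..<x0 + e}"] show ?thesis
      by (simp add: vimage_def Int_def)
  qed
  moreover have "openin (top_of_set ?S) ?T2"
    by (rule usc_compose_continuous[OF usc]) (auto intro!: continuous_intros)
  ultimately have "openin (top_of_set ?S) (?T1 \<inter> ?T2)" by (rule openin_Int)
  moreover have "w0 \<in> ?T1 \<inter> ?T2"
    using w0 e y0 unfolding Int_iff T2 by (auto simp: x0_def)
  moreover have "?T1 \<inter> ?T2 \<subseteq> {w\<in>?S. homogeneous_extension d h w < c}"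
  proof
    fix w assume "w \<in> ?T1 \<inter> ?T2"
    then have w: "w \<in> ?S" "cmod (w $ None) powr d < x0 + e" "exp_ereal (ereal d * h (base_part w)) < ereal (y0 + e)"
      unfolding Int_iff T2 by auto
    obtain y where y: "exp_ereal (ereal d * h (base_part w)) = ereal y" "0 \<le> y"
      using w(3) exp_ereal_nonneg[of "ereal d * h (base_part w)"]
      by (cases "exp_ereal (ereal d * h (base_part w))") auto
    have "cmod (w $ None) powr d * y < (x0 + e) * (y0 + e)"
      using w y x0 y0 e by (intro mult_strict_mono') auto
    then have "homogeneous_extension d h w < ereal ((x0 + e) * (y0 + e))"
      by (simp add: homogeneous_extension_def y)
    then show "w \<in> {w\<in>?S. homogeneous_extension d h w < c}" using w(1) e(2) by simp
  qed
  ultimately show "\<exists>T. openin (top_of_set ?S) T \<and> w0 \<in> T \<and> T \<subseteq> {w\<in>?S. homogeneous_extension d h w < c}"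
    by blast
qed

text \<open>Jensen's inequality for \<open>exp\<close>, in the form of its tangent at \<open>d (log \<bar>\<alpha>\<bar> + m)\<close>. Integrating the
  tangent requires only the means of \<open>log \<bar>\<alpha> + \<beta>\<zeta>\<bar>\<close> and of \<open>H\<close>.\<close>

lemma Jensen_affine_factor:
  fixes H :: "real \<Rightarrow> real"
  assumes d: "d > 0" and \<alpha>: "\<alpha> \<noteq> 0" "cmod \<beta> \<noteq> cmod \<alpha>"
    and H: "integrable circle_measure H" "m \<le> (\<integral>t. H t \<partial>circle_measure)"
    and U: "integrable circle_measure (\<lambda>t. cmod (\<alpha> + \<beta> * cis t) powr d * U t)"
    and UH: "AE t in circle_measure. U t = exp (d * H t)"
  shows "cmod \<alpha> powr d * exp (d * m) \<le> (\<integral>t. cmod (\<alpha> + \<beta> * cis t) powr d * U t \<partial>circle_measure)"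
proof -
  have ne: "\<alpha> + \<beta> * z \<noteq> 0" if "cmod z = 1" for z
  proof
    assume "\<alpha> + \<beta> * z = 0"
    then have "\<alpha> = - (\<beta> * z)" by (simp add: eq_neg_iff_add_eq_0)
    then have "cmod \<alpha> = cmod \<beta>" using that by (simp add: norm_mult)
    then show False using \<alpha>(2) by simp
  qed
  define l where "l t = ln (cmod (\<alpha> + \<beta> * cis t))" for t
  have contl: "continuous_on UNIV l"
    unfolding l_def using ne by (intro continuous_intros) auto
  have "compact ((\<lambda>z. ln (cmod (\<alpha> + \<beta> * z))) ` sphere 0 1)"
    using ne by (intro compact_continuous_image continuous_intros) auto
  then have "bounded (range l)"
    by (rule bounded_subset[OF compact_imp_bounded]) (auto simp: l_def)
  then obtain B where B: "\<And>t. \<bar>l t\<bar> \<le> B" by (auto simp: bounded_iff)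
  have intl: "integrable circle_measure l"
    by (rule integrable_circle_continuous[OF contl B])
  have meanl: "ln (cmod \<alpha>) \<le> (\<integral>t. l t \<partial>circle_measure)"
    unfolding l_def by (rule mean_ln_affine_ge[OF \<alpha>(2,1)])
  define E where "E = exp (d * (ln (cmod \<alpha>) + m))"
  \<comment> \<open>the tangent to \<open>exp\<close> at \<open>d (ln \<bar>\<alpha>\<bar> + m)\<close>, evaluated at \<open>d (l t + H t)\<close>\<close>
  define g where "g t = E * (1 - d * (ln (cmod \<alpha>) + m) + d * (l t + H t))" for t
  have intg: "integrable circle_measure g"
    unfolding g_def
    by (intro Bochner_Integration.integrable_mult_right Bochner_Integration.integrable_add intl H(1)
        finite_measure.integrable_const) auto
  have "E = E * (1 - d * (ln (cmod \<alpha>) + m) + d * (ln (cmod \<alpha>) + m))" by simp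
  also have "\<dots> \<le> E * (1 - d * (ln (cmod \<alpha>) + m) + d * ((\<integral>t. l t \<partial>circle_measure) + (\<integral>t. H t \<partial>circle_measure)))"
    using d meanl H(2) by (intro mult_left_mono add_mono) (auto simp: E_def)
  also have "\<dots> = (\<integral>t. g t \<partial>circle_measure)"
  proof -
    have "(\<integral>t. (1 - d * (ln (cmod \<alpha>) + m)) + d * (l t + H t) \<partial>circle_measure)
      = (1 - d * (ln (cmod \<alpha>) + m)) + d * ((\<integral>t. l t \<partial>circle_measure) + (\<integral>t. H t \<partial>circle_measure))"
      using intl H(1) by (subst Bochner_Integration.integral_add)
        (auto simp: measure_circle_measure_UNIV finite_measure.integrable_const)
    then show ?thesis by (simp add: g_def)
  qed
  also have "\<dots> \<le> (\<integral>t. cmod (\<alpha> + \<beta> * cis t) powr d * U t \<partial>circle_measure)"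
  proof (rule integral_mono_AE[OF intg U])
    show "AE t in circle_measure. g t \<le> cmod (\<alpha> + \<beta> * cis t) powr d * U t"
      using UH
    proof eventually_elim
      case (elim t)
      let ?x = "d * (l t + H t) - d * (ln (cmod \<alpha>) + m)"
      have "cmod (\<alpha> + \<beta> * cis t) powr d * U t = exp (d * (l t + H t))"
        using ne[of "cis t"] by (simp add: elim powr_def l_def exp_add distrib_left)
      also have "\<dots> = E * exp ?x" by (simp add: E_def flip: exp_add)
      also have "\<dots> \<ge> E * (1 + ?x)" by (intro mult_left_mono exp_ge_add_one_self) (simp add: E_def)
      finally show ?case by (simp add: g_def algebra_simps)
    qed
  qed
  also have "E = cmod \<alpha> powr d * exp (d * m)"
    using \<alpha> by (simp add: E_def powr_def exp_add distrib_left)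
  finally show ?thesis .
qed

text \<open>If \<open>\<bar>\<beta>\<bar> = \<bar>\<alpha>\<bar>\<close>, the fibre coordinate \<open>\<alpha> + \<beta>\<zeta>\<close> vanishes on the circle; the inequality then follows
  from the one for \<open>(1 - 1/n)\<beta>\<close> by dominated convergence.\<close>

lemma submean_homogeneous_extension:
  fixes h :: "complex^'n \<Rightarrow> ereal"
  assumes usc: "\<And>c. openin (top_of_set V) {z\<in>V. h z < c}"
    and fin: "\<And>z. z \<in> V \<Longrightarrow> h z < \<infinity>" and d: "d > 0"
    and sub: "\<And>a w. (\<forall>\<zeta>\<in>cball 0 1. a + \<zeta> *s w \<in> V) \<Longrightarrow> h a \<le> circle_mean h a w"
    and disc: "\<forall>\<zeta>\<in>cball 0 1. a + \<zeta> *s w \<in> {w. base_part w \<in> V}"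
  shows "homogeneous_extension d h a \<le> circle_mean (homogeneous_extension d h) a w"
proof (cases "homogeneous_extension d h a = 0")
  case True
  then show ?thesis unfolding circle_mean_def by (subst ereal_integral_nonneg) auto
next
  case False
  define z v \<alpha> \<beta> where "z = base_part a" and "v = base_part w" and "\<alpha> = a $ None" and "\<beta> = w $ None"
  have disc': "\<forall>\<zeta>\<in>cball 0 1. z + \<zeta> *s v \<in> V"
    using disc by (simp add: base_part_affine z_def v_def)
  have zV: "z \<in> V" using disc'[rule_format, of 0] by simp
  have \<alpha>: "\<alpha> \<noteq> 0" using False d by (auto simp: homogeneous_extension_def \<alpha>_def)
  obtain m where m: "h z = ereal m"
    using False fin[OF zV] d by (cases "h z") (auto simp: homogeneous_extension_def z_def)
  define k where "k t = h (z + cis t *s v)" for t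
  have kmeas [measurable]: "k \<in> borel_measurable borel"
    unfolding k_def by (rule usc_circle_measurable[OF usc disc'])
  obtain B where B: "B \<ge> 0" "\<And>t. k t \<le> ereal B"
    unfolding k_def using usc_circle_bounded_above[OF usc fin disc'] by blast
  have "ereal m \<le> ereal_integral circle_measure k"
    using sub[OF disc'] by (simp add: m circle_mean_def k_def[abs_def])
  note ge = ereal_integral_circle_ge_real[OF kmeas B(2,1) this]
  define U where "U t = real_of_ereal (exp_ereal (ereal d * k t))" for t
  have Ue: "exp_ereal (ereal d * k t) = ereal (U t)" and U0: "0 \<le> U t" "U t \<le> exp (d * B)" for t
    using B(2)[of t] d by (cases "k t"; simp add: U_def)+
  have UH: "AE t in circle_measure. U t = exp (d * real_of_ereal (k t))"
    using ge(1)
  proof eventually_elim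
    case (elim t)
    then show ?case using B(2)[of t] d by (cases "k t") (auto simp: U_def)
  qed
  have Umeas [measurable]: "U \<in> borel_measurable borel"
  proof -
    have "U = (\<lambda>t. if k t = -\<infinity> then 0 else exp (d * real_of_ereal (k t)))"
    proof
      fix t
      show "U t = (if k t = -\<infinity> then 0 else exp (d * real_of_ereal (k t)))"
        using B(2)[of t] d by (cases "k t") (auto simp: U_def)
    qed
    then show ?thesis by simp
  qed
  have contc: "continuous_on UNIV (\<lambda>t. cmod (\<alpha> + \<gamma> * cis t) powr d)" for \<gamma>
    using d by (intro continuous_on_powr' continuous_intros) auto
  have powb: "cmod (\<alpha> + \<gamma> * cis t) powr d \<le> (cmod \<alpha> + cmod \<beta>) powr d" if "cmod \<gamma> \<le> cmod \<beta>" for \<gamma> t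
    using d that norm_triangle_ineq[of \<alpha> "\<gamma> * cis t"]
    by (intro powr_mono2) (auto simp: norm_mult)
  define C where "C = (cmod \<alpha> + cmod \<beta>) powr d * exp (d * B)"
  have fb: "\<bar>cmod (\<alpha> + \<gamma> * cis t) powr d * U t\<bar> \<le> C" if "cmod \<gamma> \<le> cmod \<beta>" for \<gamma> t
    using powb[OF that, of t] U0[of t] by (auto simp: C_def abs_mult intro!: mult_mono)
  have fmeas [measurable]: "(\<lambda>t. cmod (\<alpha> + \<gamma> * cis t) powr d * U t) \<in> borel_measurable borel" for \<gamma>
    using borel_measurable_continuous_onI[OF contc[of \<gamma>]] by measurable
  have fint: "integrable circle_measure (\<lambda>t. cmod (\<alpha> + \<gamma> * cis t) powr d * U t)" if "cmod \<gamma> \<le> cmod \<beta>" for \<gamma>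
    by (rule integrable_circle_bounded[OF fmeas fb[OF that]])
  have claim: "cmod \<alpha> powr d * exp (d * m) \<le> (\<integral>t. cmod (\<alpha> + \<gamma> * cis t) powr d * U t \<partial>circle_measure)"
    if "cmod \<gamma> \<le> cmod \<beta>" "cmod \<gamma> \<noteq> cmod \<alpha>" for \<gamma>
    by (rule Jensen_affine_factor[OF d \<alpha> that(2) ge(2,3) fint[OF that(1)] UH])
  have main: "cmod \<alpha> powr d * exp (d * m) \<le> (\<integral>t. cmod (\<alpha> + \<beta> * cis t) powr d * U t \<partial>circle_measure)"
  proof (cases "cmod \<beta> = cmod \<alpha>")
    case False
    then show ?thesis by (intro claim) auto
  next
    case True
    define \<gamma> where "\<gamma> n = of_real (1 - 1 / real (Suc n)) * \<beta>" for n
    have n\<gamma>: "cmod (\<gamma> n) = (1 - 1 / real (Suc n)) * cmod \<beta>" for n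
      unfolding \<gamma>_def norm_mult norm_of_real by simp
    have \<gamma>le: "cmod (\<gamma> n) < cmod \<beta>" for n
      unfolding n\<gamma> using True \<alpha> by (simp add: field_simps)
    have \<gamma>lim: "\<gamma> \<longlonglongrightarrow> \<beta>"
    proof -
      have "(\<lambda>n. of_real (1 - 1 / real (Suc n)) * \<beta>) \<longlonglongrightarrow> of_real (1 - 0) * \<beta>"
        by (intro tendsto_intros LIMSEQ_Suc lim_1_over_n)
      then show ?thesis by (simp add: \<gamma>_def[abs_def])
    qed
    have "(\<lambda>n. \<integral>t. cmod (\<alpha> + \<gamma> n * cis t) powr d * U t \<partial>circle_measure) \<longlonglongrightarrow>
        (\<integral>t. cmod (\<alpha> + \<beta> * cis t) powr d * U t \<partial>circle_measure)"
    proof (rule integral_dominated_convergence[where w = "\<lambda>_. C"])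
      show "integrable circle_measure (\<lambda>_. C)" by (rule finite_measure.integrable_const) simp
      show "AE t in circle_measure. (\<lambda>n. cmod (\<alpha> + \<gamma> n * cis t) powr d * U t) \<longlonglongrightarrow> cmod (\<alpha> + \<beta> * cis t) powr d * U t"
        using d by (intro always_eventually allI tendsto_intros tendsto_powr' \<gamma>lim) auto
      show "AE t in circle_measure. norm (cmod (\<alpha> + \<gamma> n * cis t) powr d * U t) \<le> C" for n
        using fb[of "\<gamma> n"] \<gamma>le[of n] by simp
    qed auto
    then show ?thesis
      by (rule LIMSEQ_le_const) (use claim \<gamma>le True in \<open>auto intro!: exI[of _ 0] simp: less_imp_le less_imp_neq\<close>)
  qed
  have "circle_mean (homogeneous_extension d h) a w
      = ereal_integral circle_measure (\<lambda>t. ereal (cmod (\<alpha> + \<beta> * cis t) powr d * U t))"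
    unfolding circle_mean_def homogeneous_extension_def base_part_affine
    by (simp add: Ue[unfolded k_def] flip: z_def v_def \<alpha>_def \<beta>_def times_ereal.simps(1)) (simp add: mult.commute)
  also have "\<dots> = ereal (\<integral>t. cmod (\<alpha> + \<beta> * cis t) powr d * U t \<partial>circle_measure)"
    by (rule ereal_integral_real[OF fint]) simp
  also have "\<dots> \<ge> ereal (cmod \<alpha> powr d * exp (d * m))" using main by simp
  also (xtrans) have "ereal (cmod \<alpha> powr d * exp (d * m)) = homogeneous_extension d h a"
    by (simp add: homogeneous_extension_def m flip: z_def \<alpha>_def)
  finally show ?thesis .
qed

lemma psh_homogeneous_extension:
  fixes h :: "complex^'n \<Rightarrow> ereal"
  assumes h: "psh_on V h" and d: "d > 0"
  shows "psh_on {w. base_part w \<in> V} (homogeneous_extension d h)"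
  unfolding psh_on_def
proof (intro conjI ballI allI impI)
  have fin: "\<And>z. z \<in> V \<Longrightarrow> h z < \<infinity>" and usc: "\<And>c. openin (top_of_set V) {z\<in>V. h z < c}"
    and sub: "\<And>a w. (\<forall>\<zeta>\<in>cball 0 1. a + \<zeta> *s w \<in> V) \<Longrightarrow> h a \<le> circle_mean h a w"
    using h by (auto simp: psh_on_def)
  let ?S = "{w::complex^('n option). base_part w \<in> V}"
  show "homogeneous_extension d h w < \<infinity>" if "w \<in> ?S" for w
    using fin[of "base_part w"] that d by (cases "h (base_part w)") (auto simp: homogeneous_extension_def)
  show "openin (top_of_set ?S) {w\<in>?S. homogeneous_extension d h w < c}" for c
    by (rule usc_homogeneous_extension[OF usc fin d])
  show "homogeneous_extension d h a \<le> circle_mean (homogeneous_extension d h) a w"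
    if "\<forall>\<zeta>\<in>cball 0 1. a + \<zeta> *s w \<in> ?S" for a w
    by (rule submean_homogeneous_extension[OF usc fin d sub that])
  show "\<exists>z\<in>C. homogeneous_extension d h z \<noteq> -\<infinity>" if C: "C \<in> components ?S" for C
  proof -
    obtain z where "z \<in> C" using in_components_nonempty[OF C] by blast
    moreover have "homogeneous_extension d h z \<noteq> -\<infinity>"
      using homogeneous_extension_nonneg[of d h z] by (metis ereal_infty_less_eq(2) ereal_times(2) MInfty_neq_ereal(1) zero_ereal_def)
    ultimately show ?thesis by blast
  qed
qed

text \<open>The disc through \<open>(a + b w, 1)\<close> in the direction \<open>(r w, s r)\<close> projects to a small disc in the given
  one, while the fibre coordinate along it is \<open>1 + s r \<zeta>\<close> with an arbitrary \<open>s\<close>. This is the hypothesis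
  of \<open>log_subharmonic\<close>.\<close>

lemma log_psh_of_homogeneous_extension:
  fixes h :: "complex^'n \<Rightarrow> ereal"
  assumes u: "psh_on {w. base_part w \<in> V} (homogeneous_extension d h)" and d: "d > 0"
    and fin: "\<And>z. z \<in> V \<Longrightarrow> h z < \<infinity>"
  shows "openin (top_of_set V) {z\<in>V. h z < c}"
    and "(\<forall>\<zeta>\<in>cball 0 1. a + \<zeta> *s w \<in> V) \<Longrightarrow> h a \<le> circle_mean h a w"
proof -
  let ?S = "{w::complex^('n option). base_part w \<in> V}"
  have uscu: "\<And>c. openin (top_of_set ?S) {w\<in>?S. homogeneous_extension d h w < c}"
    and sub: "\<And>a w. (\<forall>\<zeta>\<in>cball 0 1. a + \<zeta> *s w \<in> ?S) \<Longrightarrow>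
      homogeneous_extension d h a \<le> circle_mean (homogeneous_extension d h) a w"
    using u by (auto simp: psh_on_def)
  have usc: "openin (top_of_set V) {z\<in>V. h z < c}" for c
  proof (cases c)
    case (real r)
    have "h z < c \<longleftrightarrow> homogeneous_extension d h (fibre_join 1 z) < ereal (exp (d * r))" for z
      using exp_ereal_mult_less_iff[OF d, of "exp (d * r)" "h z"] d real
      by (simp add: homogeneous_extension_def)
    moreover have "openin (top_of_set V) {z\<in>V. homogeneous_extension d h (fibre_join 1 z) < ereal (exp (d * r))}"
      by (rule usc_compose_continuous[OF uscu]) (auto intro!: continuous_intros)
    ultimately show ?thesis by simp
  next
    case PInf
    then have "{z\<in>V. h z < c} = V" using fin by auto
    then show ?thesis by (simp only: openin_subtopology_self)
  next
    case MInf
    then have "{z\<in>V. h z < c} = {}" by auto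
    then show ?thesis by (simp only: openin_empty)
  qed
  then show "openin (top_of_set V) {z\<in>V. h z < c}" .
  assume disc: "\<forall>\<zeta>\<in>cball 0 1. a + \<zeta> *s w \<in> V"
  define k where "k \<zeta> = h (a + \<zeta> *s w)" for \<zeta>
  have "k 0 \<le> ereal_integral circle_measure (\<lambda>t. k (cis t))"
  proof (rule log_subharmonic[OF _ _ _ d])
    show "openin (top_of_set (cball 0 1)) {z \<in> cball 0 1. k z < c}" for c
      unfolding k_def
      by (rule usc_compose_continuous[OF usc]) (use disc in \<open>auto intro!: continuous_intros\<close>)
    show "k z < \<infinity>" if "z \<in> cball 0 1" for z
      using fin[OF disc[rule_format, OF that]] by (simp add: k_def)
    show "(\<lambda>t. k (cis t)) \<in> borel_measurable borel"
      unfolding k_def by (rule usc_circle_measurable[OF usc disc])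
    fix b s :: complex and r :: real assume r: "r > 0" "cmod b + r \<le> 1"
    let ?a = "fibre_join 1 (a + b *s w)" and ?w = "fibre_join (s * of_real r) (of_real r *s w)"
    have line: "?a + \<zeta> *s ?w = fibre_join (1 + s * of_real r * \<zeta>) (a + (b + of_real r * \<zeta>) *s w)" for \<zeta>
      unfolding fibre_join_affine
      by (simp add: vector_smult_assoc vector_sadd_rdistrib mult_ac add_ac)
    have "homogeneous_extension d h ?a \<le> circle_mean (homogeneous_extension d h) ?a ?w"
    proof (rule sub, intro ballI)
      fix \<zeta> :: complex assume "\<zeta> \<in> cball 0 1"
      then have le: "r * cmod \<zeta> \<le> r" using r(1) by (simp add: mult_left_le)
      have "cmod (of_real r * \<zeta>) = r * cmod \<zeta>" using r(1) by (simp add: norm_mult)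
      then have "cmod (b + of_real r * \<zeta>) \<le> cmod b + r"
        using norm_triangle_ineq[of b "of_real r * \<zeta>"] le by linarith
      then have "b + of_real r * \<zeta> \<in> cball 0 1" using r by simp
      then show "?a + \<zeta> *s ?w \<in> ?S"
        using disc[rule_format, OF \<open>b + of_real r * \<zeta> \<in> cball 0 1\<close>] unfolding line mem_Collect_eq fibre_join_simps by blast
    qed
    then show "exp_ereal (ereal d * k b) \<le>
      ereal_integral circle_measure (\<lambda>t. ereal (cmod (1 + s * complex_of_real r * cis t) powr d)
         * exp_ereal (ereal d * k (b + complex_of_real r * cis t)))"
      unfolding circle_mean_def line by (simp add: homogeneous_extension_def k_def)
  qed
  then show "h a \<le> circle_mean h a w" by (simp add: k_def circle_mean_def)
qed

text \<open>If \<open>h = -\<infinity>\<close> near a point \<open>y\<close>, then for every \<open>z\<close> close by, the circle centred at \<open>z\<close> through \<open>y\<close> has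
  an arc on which \<open>h = -\<infinity>\<close>. The mean over this circle is \<open>-\<infinity>\<close>, and so is \<open>h z\<close>. The radius of the
  neighbourhood of \<open>x\<close> obtained depends only on its distance to the boundary of \<open>V\<close>.\<close>

lemma minus_infinity_propagates:
  fixes h :: "complex^'n \<Rightarrow> ereal"
  assumes V: "open V" and usc: "\<And>c. openin (top_of_set V) {z\<in>V. h z < c}"
    and fin: "\<And>z. z \<in> V \<Longrightarrow> h z < \<infinity>"
    and sub: "\<And>a w. (\<forall>\<zeta>\<in>cball 0 1. a + \<zeta> *s w \<in> V) \<Longrightarrow> h a \<le> circle_mean h a w"
    and x: "x \<in> V" "x \<in> closure (interior {z\<in>V. h z = -\<infinity>})"
  shows "x \<in> interior {z\<in>V. h z = -\<infinity>}"
proof -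
  let ?N = "{z\<in>V. h z = -\<infinity>}"
  obtain R where R: "R > 0" "ball x R \<subseteq> V" using V x(1) openE by blast
  obtain y where y: "y \<in> interior ?N" "dist y x < R / 4"
    using x(2) R(1) unfolding closure_approachable by (meson zero_less_divide_iff zero_less_numeral)
  obtain \<rho> where \<rho>: "\<rho> > 0" "ball y \<rho> \<subseteq> ?N"
    using y(1) by (auto simp: mem_interior)
  have "ball x (R / 4) \<subseteq> ?N"
  proof
    fix z assume z: "z \<in> ball x (R / 4)"
    define w where "w = y - z"
    have w: "norm w < R / 2"
      using z y(2) dist_triangle[of y z x] by (simp add: w_def dist_norm norm_minus_commute)
    have disc: "\<forall>\<zeta>\<in>cball 0 1. z + \<zeta> *s w \<in> V"
    proof
      fix \<zeta> :: complex assume "\<zeta> \<in> cball 0 1"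
      then have "norm (\<zeta> *s w) \<le> 1 * norm w"
        unfolding norm_complex_smult by (intro mult_right_mono) auto
      then have "dist (z + \<zeta> *s w) z < R / 2" using w by (simp add: dist_norm)
      then have "dist x (z + \<zeta> *s w) < R"
        using z dist_triangle[of x "z + \<zeta> *s w" z] R(1) by (simp add: dist_commute)
      then show "z + \<zeta> *s w \<in> V" using R(2) by auto
    qed
    have zV: "z \<in> V" using disc[rule_format, of 0] by simp
    have "h z = -\<infinity>"
    proof (rule ccontr)
      assume "h z \<noteq> -\<infinity>"
      then obtain m where m: "h z = ereal m" using fin[OF zV] by (cases "h z") auto
      define k where "k t = h (z + cis t *s w)" for t
      have kmeas: "k \<in> borel_measurable borel"
        unfolding k_def by (rule usc_circle_measurable[OF usc disc])
      obtain B where B: "B \<ge> 0" "\<And>t. k t \<le> ereal B"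
        unfolding k_def using usc_circle_bounded_above[OF usc fin disc] by blast
      have "ereal m \<le> ereal_integral circle_measure k"
        using sub[OF disc] by (simp add: m circle_mean_def k_def[abs_def])
      from ereal_integral_circle_ge_real(1)[OF kmeas B(2,1) this]
      have ae: "AE t in circle_measure. k t \<noteq> -\<infinity>" .
      have "continuous_on UNIV (\<lambda>t. z + cis t *s w)" by (intro continuous_intros)
      then have "isCont (\<lambda>t. z + cis t *s w) 0" by (simp add: continuous_on_eq_continuous_at)
      then obtain \<delta> where \<delta>: "\<delta> > 0" "\<And>t. dist t 0 < \<delta> \<Longrightarrow> dist (z + cis t *s w) (z + cis 0 *s w) < \<rho>"
        using \<rho>(1) unfolding continuous_at_eps_delta by blast
      define \<eta> where "\<eta> = min (\<delta> / 2) 1"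
      have \<eta>: "0 < \<eta>" "\<eta> < \<delta>" "\<eta> \<le> 2 * pi" using \<delta>(1) pi_gt3 by (auto simp: \<eta>_def)
      have kinf: "k t = -\<infinity>" if "t \<in> {0..\<eta>}" for t
      proof -
        have "dist (z + cis t *s w) y < \<rho>"
          using \<delta>(2)[of t] that \<eta> by (simp add: w_def)
        then show ?thesis using \<rho>(2) by (auto simp: k_def dist_commute)
      qed
      have "AE t in circle_measure. t \<notin> {0..\<eta>}"
        using ae by eventually_elim (use kinf in blast)
      then have "emeasure circle_measure {0..\<eta>} = 0"
        using AE_iff_measurable[of "{0..\<eta>}" circle_measure "\<lambda>t. t \<notin> {0..\<eta>}"]
        by (auto simp del: emeasure_uniform_measure simp: atLeastAtMost_def atLeast_def atMost_def Int_def)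
      moreover have "emeasure circle_measure {0..\<eta>} = emeasure lborel ({0..2*pi} \<inter> {0..\<eta>}) / emeasure lborel {0..2*pi}"
        by (rule emeasure_uniform_measure) auto
      moreover have "{0..2*pi} \<inter> {0..\<eta>} = {0..\<eta>}" using \<eta> by auto
      ultimately show False using \<eta> by (simp add: divide_ennreal)
    qed
    then show "z \<in> ?N" using zV by simp
  qed
  moreover have "x \<in> ball x (R / 4)" using R(1) by simp
  ultimately show ?thesis unfolding mem_interior using R(1) by (meson zero_less_divide_iff zero_less_numeral)
qed

lemma psh_on_cong:
  assumes "\<And>z. z \<in> S \<Longrightarrow> u z = v z"
  shows "psh_on S u \<longleftrightarrow> psh_on S v"
proof -
  have "{z\<in>S. u z < c} = {z\<in>S. v z < c}" for c using assms by auto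
  moreover have "(u a \<le> circle_mean u a w) = (v a \<le> circle_mean v a w)"
    if "\<forall>\<zeta>\<in>cball 0 1. a + \<zeta> *s w \<in> S" for a w
  proof -
    have "u a = v a" using assms that[rule_format, of 0] by simp
    moreover have "circle_mean u a w = circle_mean v a w"
      unfolding circle_mean_def using assms circle_in_disc[OF that] by simp
    ultimately show ?thesis by simp
  qed
  moreover have "(\<exists>z\<in>C. u z \<noteq> -\<infinity>) = (\<exists>z\<in>C. v z \<noteq> -\<infinity>)" if "C \<in> components S" for C
    using assms in_components_subset[OF that] by (metis subsetD)
  ultimately show ?thesis unfolding psh_on_def using assms by (simp cong: ball_cong)
qed

section \<open>Frames and coordinates of the dual bundle\<close>

lemma line_bundle_fibre:
  assumes L: "holomorphic_line_bundle X A L" and i: "i \<in> Idx L" "x \<in> Dom L i"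
  shows "x \<in> topspace X" "bij_betw (Coord L i) (fibre L x) UNIV"
    and "\<And>\<xi> \<eta>. \<xi> \<in> fibre L x \<Longrightarrow> \<eta> \<in> fibre L x \<Longrightarrow> Add L \<xi> \<eta> \<in> fibre L x"
    and "\<And>c \<xi>. \<xi> \<in> fibre L x \<Longrightarrow> Scale L c \<xi> \<in> fibre L x"
    and "\<And>\<xi> \<eta>. \<xi> \<in> fibre L x \<Longrightarrow> \<eta> \<in> fibre L x \<Longrightarrow> Coord L i (Add L \<xi> \<eta>) = Coord L i \<xi> + Coord L i \<eta>"
    and "\<And>c \<xi>. \<xi> \<in> fibre L x \<Longrightarrow> Coord L i (Scale L c \<xi>) = c * Coord L i \<xi>"
proof -
  show x: "x \<in> topspace X" using L i unfolding holomorphic_line_bundle_def by blast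
  show "bij_betw (Coord L i) (fibre L x) UNIV" using L i unfolding holomorphic_line_bundle_def by blast
  show "\<And>\<xi> \<eta>. \<xi> \<in> fibre L x \<Longrightarrow> \<eta> \<in> fibre L x \<Longrightarrow> Add L \<xi> \<eta> \<in> fibre L x"
    "\<And>c \<xi>. \<xi> \<in> fibre L x \<Longrightarrow> Scale L c \<xi> \<in> fibre L x"
    using L x unfolding holomorphic_line_bundle_def by blast+
  show "\<And>\<xi> \<eta>. \<xi> \<in> fibre L x \<Longrightarrow> \<eta> \<in> fibre L x \<Longrightarrow> Coord L i (Add L \<xi> \<eta>) = Coord L i \<xi> + Coord L i \<eta>"
    "\<And>c \<xi>. \<xi> \<in> fibre L x \<Longrightarrow> Coord L i (Scale L c \<xi>) = c * Coord L i \<xi>"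
    using L i unfolding holomorphic_line_bundle_def by blast+
qed

lemma line_bundle_frame:
  assumes L: "holomorphic_line_bundle X A L" and i: "i \<in> Idx L" "x \<in> Dom L i"
  shows "frame L i x \<in> fibre L x" "Coord L i (frame L i x) = 1"
    and "\<And>\<xi>. \<xi> \<in> fibre L x \<Longrightarrow> \<xi> = Scale L (Coord L i \<xi>) (frame L i x)"
proof -
  note fib = line_bundle_fibre[OF L i]
  have 1: "1 \<in> Coord L i ` fibre L x" using fib(2) by (simp add: bij_betw_def)
  show fr: "frame L i x \<in> fibre L x" unfolding frame_def by (rule inv_into_into[OF 1])
  show fr1: "Coord L i (frame L i x) = 1" unfolding frame_def by (rule f_inv_into_f[OF 1])
  fix \<xi> assume \<xi>: "\<xi> \<in> fibre L x"
  have "Coord L i (Scale L (Coord L i \<xi>) (frame L i x)) = Coord L i \<xi>"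
    using fib(6)[OF fr] by (simp add: fr1)
  then show "\<xi> = Scale L (Coord L i \<xi>) (frame L i x)"
    using fib(2,4) fr \<xi> by (auto simp: bij_betw_def inj_on_def)
qed

lemma line_bundle_index:
  assumes "holomorphic_line_bundle X A L" "x \<in> topspace X"
  obtains i where "i \<in> Idx L" "x \<in> Dom L i"
  using assms unfolding holomorphic_line_bundle_def by blast

text \<open>Comparing the two sides in the coordinate \<open>i\<close> shows that the transition function has no zeros.\<close>

lemma frame_eq_transition_scale:
  assumes L: "holomorphic_line_bundle X A L" and i: "i \<in> Idx L" "x \<in> Dom L i"
    and j: "j \<in> Idx L" "x \<in> Dom L j"
  shows "frame L i x = Scale L (transition L i j x) (frame L j x)" "transition L i j x \<noteq> 0"
proof -
  show eq: "frame L i x = Scale L (transition L i j x) (frame L j x)"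
    unfolding transition_def by (rule line_bundle_frame(3)[OF L j line_bundle_frame(1)[OF L i]])
  have "1 = transition L i j x * Coord L i (frame L j x)"
    using line_bundle_fibre(6)[OF L i line_bundle_frame(1)[OF L j], of "transition L i j x"] line_bundle_frame(2)[OF L i]
    by (simp flip: eq)
  then show "transition L i j x \<noteq> 0" by auto
qed

lemma dual_bundle_sel [simp]:
  "Prj (dual_bundle L) = fst" "Idx (dual_bundle L) = Idx L" "Dom (dual_bundle L) = Dom L"
  "Coord (dual_bundle L) i \<xi> = snd \<xi> (frame L i (fst \<xi>))"
  by (simp_all add: dual_bundle_def split: prod.split)

lemma dual_fibre_iff:
  assumes L: "holomorphic_line_bundle X A L" and i: "i \<in> Idx L" "x \<in> Dom L i"
  shows "\<xi> \<in> fibre (dual_bundle L) x \<longleftrightarrow> fst \<xi> = x \<and> snd \<xi> \<in> extensional (fibre L x) \<and>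
    (\<forall>\<zeta>\<in>fibre L x. \<forall>\<eta>\<in>fibre L x. snd \<xi> (Add L \<zeta> \<eta>) = snd \<xi> \<zeta> + snd \<xi> \<eta>) \<and>
    (\<forall>c. \<forall>\<zeta>\<in>fibre L x. snd \<xi> (Scale L c \<zeta>) = c * snd \<xi> \<zeta>)"
proof -
  have "frame L i x \<in> fibre L x" by (rule line_bundle_frame(1)[OF L i])
  then have "x \<in> Prj L ` Tot L" unfolding fibre_def by (auto intro: rev_image_eqI)
  moreover have "\<xi> \<in> fibre (dual_bundle L) x \<longleftrightarrow> \<xi> \<in> Tot (dual_bundle L) \<and> fst \<xi> = x"
    by (simp add: fibre_def)
  moreover have "\<xi> \<in> Tot (dual_bundle L) \<longleftrightarrow> fst \<xi> \<in> Prj L ` Tot L \<and> snd \<xi> \<in> extensional (fibre L (fst \<xi>)) \<and>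
    (\<forall>\<zeta>\<in>fibre L (fst \<xi>). \<forall>\<eta>\<in>fibre L (fst \<xi>). snd \<xi> (Add L \<zeta> \<eta>) = snd \<xi> \<zeta> + snd \<xi> \<eta>) \<and>
    (\<forall>c. \<forall>\<zeta>\<in>fibre L (fst \<xi>). snd \<xi> (Scale L c \<zeta>) = c * snd \<xi> \<zeta>)"
    by (cases \<xi>) (simp add: dual_bundle_def)
  ultimately show ?thesis by (cases "fst \<xi> = x") simp_all
qed

text \<open>A functional on a fibre is determined by its value on the frame; functionals are restricted to the
  fibre, so they are equal as functions as well.\<close>

lemma dual_coord_bij:
  assumes L: "holomorphic_line_bundle X A L" and i: "i \<in> Idx L" "x \<in> Dom L i"
  shows "bij_betw (Coord (dual_bundle L) i) (fibre (dual_bundle L) x) UNIV"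
  unfolding bij_betw_def
proof
  note fib = line_bundle_fibre[OF L i] and fr = line_bundle_frame[OF L i] and dual = dual_fibre_iff[OF L i]
  show "inj_on (Coord (dual_bundle L) i) (fibre (dual_bundle L) x)"
  proof (rule inj_onI)
    fix \<xi> \<eta> assume \<xi>: "\<xi> \<in> fibre (dual_bundle L) x" and \<eta>: "\<eta> \<in> fibre (dual_bundle L) x"
      and eq: "Coord (dual_bundle L) i \<xi> = Coord (dual_bundle L) i \<eta>"
    have "snd \<xi> = snd \<eta>"
    proof (rule extensionalityI)
      show "snd \<xi> \<in> extensional (fibre L x)" "snd \<eta> \<in> extensional (fibre L x)"
        using \<xi> \<eta> unfolding dual by auto
      fix \<zeta> assume "\<zeta> \<in> fibre L x"
      then have \<zeta>: "\<zeta> = Scale L (Coord L i \<zeta>) (frame L i x)" by (rule fr(3))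
      have "snd \<xi> (Scale L (Coord L i \<zeta>) (frame L i x)) = snd \<eta> (Scale L (Coord L i \<zeta>) (frame L i x))"
        using \<xi> \<eta> eq fr(1) unfolding dual by simp
      then show "snd \<xi> \<zeta> = snd \<eta> \<zeta>" using \<zeta> by simp
    qed
    then show "\<xi> = \<eta>" using \<xi> \<eta> unfolding dual by (simp add: prod_eq_iff)
  qed
  have "c \<in> Coord (dual_bundle L) i ` fibre (dual_bundle L) x" for c
  proof
    let ?\<xi> = "(x, restrict (\<lambda>\<zeta>. c * Coord L i \<zeta>) (fibre L x))"
    show "c = Coord (dual_bundle L) i ?\<xi>" using fr by simp
    show "?\<xi> \<in> fibre (dual_bundle L) x"
      unfolding dual using fib(3-6) by (simp add: distrib_left)
  qed
  then show "Coord (dual_bundle L) i ` fibre (dual_bundle L) x = UNIV" by auto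
qed

lemma dual_scale:
  assumes L: "holomorphic_line_bundle X A L" and i: "i \<in> Idx L" "x \<in> Dom L i"
    and \<xi>: "\<xi> \<in> fibre (dual_bundle L) x"
  shows "Scale (dual_bundle L) c \<xi> \<in> fibre (dual_bundle L) x"
    "Coord (dual_bundle L) i (Scale (dual_bundle L) c \<xi>) = c * Coord (dual_bundle L) i \<xi>"
proof -
  note fib = line_bundle_fibre[OF L i] and fr = line_bundle_frame[OF L i] and dual = dual_fibre_iff[OF L i]
  have fx: "fst \<xi> = x" using \<xi> unfolding dual by simp
  then have eq: "Scale (dual_bundle L) c \<xi> = (x, restrict (\<lambda>\<zeta>. c * snd \<xi> \<zeta>) (fibre L x))"
    by (cases \<xi>) (simp add: dual_bundle_def)
  show "Scale (dual_bundle L) c \<xi> \<in> fibre (dual_bundle L) x"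
    unfolding eq using \<xi> fib(3,4) unfolding dual by (simp add: distrib_left)
  show "Coord (dual_bundle L) i (Scale (dual_bundle L) c \<xi>) = c * Coord (dual_bundle L) i \<xi>"
    unfolding eq using fr(1) fx by simp
qed

lemma dual_frame:
  assumes L: "holomorphic_line_bundle X A L" and i: "i \<in> Idx L" "x \<in> Dom L i"
  shows "frame (dual_bundle L) i x \<in> fibre (dual_bundle L) x"
    "Coord (dual_bundle L) i (frame (dual_bundle L) i x) = 1"
    "\<And>\<xi>. \<xi> \<in> fibre (dual_bundle L) x \<Longrightarrow>
      \<xi> = Scale (dual_bundle L) (Coord (dual_bundle L) i \<xi>) (frame (dual_bundle L) i x)"
proof -
  note bij = dual_coord_bij[OF L i]
  have 1: "1 \<in> Coord (dual_bundle L) i ` fibre (dual_bundle L) x" using bij by (simp add: bij_betw_def)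
  show fr: "frame (dual_bundle L) i x \<in> fibre (dual_bundle L) x" unfolding frame_def by (rule inv_into_into[OF 1])
  show fr1: "Coord (dual_bundle L) i (frame (dual_bundle L) i x) = 1"
    unfolding frame_def by (rule f_inv_into_f[OF 1])
  fix \<xi> assume \<xi>: "\<xi> \<in> fibre (dual_bundle L) x"
  have "Coord (dual_bundle L) i (Scale (dual_bundle L) (Coord (dual_bundle L) i \<xi>) (frame (dual_bundle L) i x))
     = Coord (dual_bundle L) i \<xi>"
    using dual_scale(2)[OF L i fr] fr1 by simp
  then show "\<xi> = Scale (dual_bundle L) (Coord (dual_bundle L) i \<xi>) (frame (dual_bundle L) i x)"
    using bij dual_scale(1)[OF L i fr] \<xi> unfolding bij_betw_def inj_on_def by metis
qed

text \<open>The dual coordinate is evaluation at the frame, hence it transforms opposite to the coordinate on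
  \<open>L\<close>.\<close>

lemma dual_coord_change:
  assumes L: "holomorphic_line_bundle X A L" and i: "i \<in> Idx L" "x \<in> Dom L i"
    and j: "j \<in> Idx L" "x \<in> Dom L j" and \<xi>: "\<xi> \<in> fibre (dual_bundle L) x"
  shows "Coord (dual_bundle L) i \<xi> = transition L i j x * Coord (dual_bundle L) j \<xi>"
proof -
  have fx: "fst \<xi> = x" using \<xi> by (simp add: fibre_def)
  have "snd \<xi> (frame L i x) = snd \<xi> (Scale L (transition L i j x) (frame L j x))"
    using frame_eq_transition_scale(1)[OF L i j] by simp
  also have "\<dots> = transition L i j x * snd \<xi> (frame L j x)"
    using \<xi> line_bundle_frame(1)[OF L j] unfolding dual_fibre_iff[OF L i] by simp
  finally show ?thesis by (simp add: fx)
qed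

lemma dual_Tot_index:
  assumes L: "holomorphic_line_bundle X A L" and \<xi>: "\<xi> \<in> Tot (dual_bundle L)"
  obtains i where "i \<in> Idx L" "fst \<xi> \<in> Dom L i" "\<xi> \<in> fibre (dual_bundle L) (fst \<xi>)"
proof -
  have "fst \<xi> \<in> Prj L ` Tot L" using \<xi> by (auto simp: dual_bundle_def)
  then have "fst \<xi> \<in> topspace X" using L unfolding holomorphic_line_bundle_def by blast
  then obtain i where "i \<in> Idx L" "fst \<xi> \<in> Dom L i" by (rule line_bundle_index[OF L])
  then show ?thesis using that \<xi> by (simp add: fibre_def)
qed

lemma fibre_Tot: "\<xi> \<in> fibre L x \<Longrightarrow> \<xi> \<in> Tot L"
  by (simp add: fibre_def)

section \<open>Charts of the base and of the total space\<close>

lemma chart_inj_on: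
  assumes "complex_manifold X A" "c \<in> A"
  shows "inj_on (snd c) (fst c)"
proof -
  have "homeomorphic_map (subtopology X (fst c)) (top_of_set (snd c ` fst c)) (snd c)" "openin X (fst c)"
    using assms by (auto simp: complex_manifold_def)
  then have hom: "homeomorphic_map (subtopology X (fst c)) (top_of_set (snd c ` fst c)) (snd c)"
    and "fst c \<subseteq> topspace X" by (auto dest: openin_subset)
  then have "topspace (subtopology X (fst c)) = fst c" by (intro topspace_subtopology_subset)
  then show ?thesis using homeomorphic_imp_injective_map[OF hom] by (simp only:)
qed

lemma chart_inv_eq [simp]:
  assumes "complex_manifold X A" "c \<in> A" "x \<in> fst c"
  shows "chart_inv c (snd c x) = x"
  unfolding chart_inv_def by (rule inv_into_f_f[OF chart_inj_on[OF assms(1,2)] assms(3)])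

lemma open_chart_image:
  assumes X: "complex_manifold X A" "c \<in> A" and U: "openin X U"
  shows "open (snd c ` (fst c \<inter> U))"
proof -
  have hom: "homeomorphic_map (subtopology X (fst c)) (top_of_set (snd c ` fst c)) (snd c)"
    and op: "open (snd c ` fst c)"
    using X by (auto simp: complex_manifold_def)
  have "openin (subtopology X (fst c)) (fst c \<inter> U)"
    using U by (simp add: openin_subtopology_Int2)
  then have "openin (top_of_set (snd c ` fst c)) (snd c ` (fst c \<inter> U))"
    using homeomorphic_imp_open_map[OF hom] by (auto simp: open_map_def)
  then show ?thesis using op openin_open_trans by blast
qed

lemma openin_chart_vimage:
  assumes X: "complex_manifold X A" "c \<in> A" and W: "open W"
  shows "openin X {x \<in> fst c. snd c x \<in> W}"
proof -
  have hom: "homeomorphic_map (subtopology X (fst c)) (top_of_set (snd c ` fst c)) (snd c)"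
    and op: "openin X (fst c)"
    using X by (auto simp: complex_manifold_def)
  have ts: "topspace (subtopology X (fst c)) = fst c"
    using op openin_subset by (metis topspace_subtopology_subset)
  have "openin (top_of_set (snd c ` fst c)) (snd c ` fst c \<inter> W)" using W by (simp add: openin_open_Int)
  then have "openin (subtopology X (fst c)) {x \<in> topspace (subtopology X (fst c)). snd c x \<in> snd c ` fst c \<inter> W}"
    by (rule openin_continuous_map_preimage[OF homeomorphic_imp_continuous_map[OF hom]])
  moreover have "{x \<in> topspace (subtopology X (fst c)). snd c x \<in> snd c ` fst c \<inter> W} = {x \<in> fst c. snd c x \<in> W}"
    unfolding ts by auto
  ultimately show ?thesis using op by (metis openin_trans_full)
qed

definition dual_chart ::
    "('a, 'e, 'i) line_bundle \<Rightarrow> ('a, 'n::finite) chart \<Rightarrow> 'i \<Rightarrow> ('a \<times> ('e \<Rightarrow> complex), 'n option) chart" where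
  "dual_chart L c i =
     ({\<xi> \<in> Tot (dual_bundle L). fst \<xi> \<in> fst c \<inter> Dom L i},
      \<lambda>\<xi>. fibre_join (Coord (dual_bundle L) i \<xi>) (snd c (fst \<xi>)))"

lemma total_atlas_dual: "total_atlas A (dual_bundle L) = (\<lambda>(c, i). dual_chart L c i) ` (A \<times> Idx L)"
  unfolding total_atlas_def dual_chart_def fibre_join_def dual_bundle_sel(1-3) ..

lemma dual_chart_domain_iff:
  "\<xi> \<in> fst (dual_chart L c i) \<longleftrightarrow> \<xi> \<in> fibre (dual_bundle L) (fst \<xi>) \<and> fst \<xi> \<in> fst c \<and> fst \<xi> \<in> Dom L i"
  by (auto simp: dual_chart_def fibre_def)

lemma dual_chart_coord:
  "snd (dual_chart L c i) \<xi> = fibre_join (Coord (dual_bundle L) i \<xi>) (snd c (fst \<xi>))"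
  by (simp add: dual_chart_def)

lemma dual_chart_domain_Tot: "fst (dual_chart L c i) \<inter> Tot (dual_bundle L) = fst (dual_chart L c i)"
  by (auto simp: dual_chart_def)

lemma dual_chart_inv_eq:
  assumes X: "complex_manifold X A" and L: "holomorphic_line_bundle X A L" and c: "c \<in> A" and i: "i \<in> Idx L"
    and \<xi>: "\<xi> \<in> fst (dual_chart L c i)"
  shows "chart_inv (dual_chart L c i) (snd (dual_chart L c i) \<xi>) = \<xi>"
  unfolding chart_inv_def
proof (rule inv_into_f_f[OF inj_onI \<xi>])
  let ?L = "dual_bundle L"
  fix \<xi> \<eta> assume \<xi>: "\<xi> \<in> fst (dual_chart L c i)" and \<eta>: "\<eta> \<in> fst (dual_chart L c i)"
    and eq: "snd (dual_chart L c i) \<xi> = snd (dual_chart L c i) \<eta>"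
  have "snd c (fst \<xi>) = snd c (fst \<eta>)" and co: "Coord ?L i \<xi> = Coord ?L i \<eta>"
    using eq unfolding dual_chart_coord by (metis fibre_join_simps)+
  then have f: "fst \<xi> = fst \<eta>"
    using inj_onD[OF chart_inj_on[OF X c]] \<xi> \<eta> unfolding dual_chart_domain_iff by blast
  have "fst \<eta> \<in> Dom L i" using \<eta> unfolding dual_chart_domain_iff by blast
  then have inj: "inj_on (Coord ?L i) (fibre ?L (fst \<eta>))"
    using dual_coord_bij[OF L i] unfolding bij_betw_def by blast
  have "\<xi> \<in> fibre ?L (fst \<eta>)" "\<eta> \<in> fibre ?L (fst \<eta>)"
    using \<xi> \<eta> unfolding dual_chart_domain_iff f by blast+
  then show "\<xi> = \<eta>" using inj co unfolding inj_on_def by blast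
qed

lemma dual_chart_image:
  assumes L: "holomorphic_line_bundle X A L" and i: "i \<in> Idx L"
  shows "snd (dual_chart L c i) ` fst (dual_chart L c i) = {w. base_part w \<in> snd c ` (fst c \<inter> Dom L i)}"
proof
  let ?L = "dual_bundle L" and ?C = "dual_chart L c i"
  show "snd ?C ` fst ?C \<subseteq> {w. base_part w \<in> snd c ` (fst c \<inter> Dom L i)}"
    by (auto simp: dual_chart_coord dual_chart_domain_iff simp del: dual_bundle_sel)
  show "{w. base_part w \<in> snd c ` (fst c \<inter> Dom L i)} \<subseteq> snd ?C ` fst ?C"
  proof
    fix w assume "w \<in> {w. base_part w \<in> snd c ` (fst c \<inter> Dom L i)}"
    then obtain x where x: "x \<in> fst c" "x \<in> Dom L i" "base_part w = snd c x" by auto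
    obtain \<xi> where \<xi>: "\<xi> \<in> fibre ?L x" "Coord ?L i \<xi> = w $ None"
      using dual_coord_bij[OF L i x(2)] unfolding bij_betw_def by (metis UNIV_I imageE)
    have fx: "fst \<xi> = x" using \<xi>(1) by (simp add: fibre_def)
    have "snd ?C \<xi> = fibre_join (w $ None) (base_part w)" unfolding dual_chart_coord \<xi>(2) fx x(3) ..
    also have "\<dots> = w" by (simp add: fibre_join_def base_part_def vec_eq_iff split: option.split)
    finally have "w = snd ?C \<xi>" by simp
    moreover have "\<xi> \<in> fst ?C" using \<xi>(1) fx x by (simp add: dual_chart_domain_iff)
    ultimately show "w \<in> snd ?C ` fst ?C" by blast
  qed
qed

lemma psh_on_dual_chart_iff:
  assumes X: "complex_manifold X A" and L: "holomorphic_line_bundle X A L"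
    and uh: "induces_metric d L u h" and c: "c \<in> A" and i: "i \<in> Idx L"
  shows "psh_on (snd (dual_chart L c i) ` (fst (dual_chart L c i) \<inter> Tot (dual_bundle L))) (u \<circ> chart_inv (dual_chart L c i)) \<longleftrightarrow>
    psh_on {w. base_part w \<in> snd c ` (fst c \<inter> Dom L i)} (homogeneous_extension d (h i \<circ> chart_inv c))"
proof -
  let ?L = "dual_bundle L" and ?C = "dual_chart L c i"
  have "(u \<circ> chart_inv ?C) w = homogeneous_extension d (h i \<circ> chart_inv c) w" if w: "w \<in> snd ?C ` fst ?C" for w
  proof -
    obtain \<xi> where \<xi>: "\<xi> \<in> fst ?C" "w = snd ?C \<xi>" using w by blast
    have "chart_inv ?C w = \<xi>" unfolding \<xi>(2) by (rule dual_chart_inv_eq[OF X L c i \<xi>(1)])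
    moreover have "u \<xi> = ereal (cmod (Coord ?L i \<xi>) powr d) * exp_ereal (ereal d * h i (fst \<xi>))"
      using uh \<xi>(1) i unfolding induces_metric_def dual_chart_domain_iff by blast
    moreover have "chart_inv c (snd c (fst \<xi>)) = fst \<xi>"
      by (rule chart_inv_eq[OF X c]) (use \<xi>(1)[unfolded dual_chart_domain_iff] in blast)
    ultimately show ?thesis by (simp add: homogeneous_extension_def \<xi>(2) dual_chart_coord)
  qed
  then have "psh_on (snd ?C ` fst ?C) (u \<circ> chart_inv ?C) \<longleftrightarrow>
      psh_on (snd ?C ` fst ?C) (homogeneous_extension d (h i \<circ> chart_inv c))"
    by (rule psh_on_cong)
  then show ?thesis unfolding dual_chart_domain_Tot unfolding dual_chart_image[OF L i] .
qed

lemma mfd_psh_on_dual_iff: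
  "mfd_psh_on (total_atlas A (dual_bundle L)) (Tot (dual_bundle L)) u \<longleftrightarrow>
    (\<forall>c\<in>A. \<forall>i\<in>Idx L. psh_on (snd (dual_chart L c i) ` (fst (dual_chart L c i) \<inter> Tot (dual_bundle L)))
      (u \<circ> chart_inv (dual_chart L c i)))"
proof -
  have prod: "(\<forall>x\<in>A \<times> Idx L. Q x) \<longleftrightarrow> (\<forall>c\<in>A. \<forall>i\<in>Idx L. Q (c, i))" for Q by auto
  show ?thesis unfolding mfd_psh_on_def total_atlas_dual ball_simps(9) prod prod.case ..
qed

text \<open>In the charts of the total space, the function of a metric is the homogeneous extension of its
  weights, over the same base chart and trivialization. So no change of coordinates has to be
  considered.\<close>

lemma homogeneous_psh_iff_charts:
  assumes X: "complex_manifold X A" and L: "holomorphic_line_bundle X A L" and uh: "induces_metric d L u h"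
  shows "mfd_psh_on (total_atlas A (dual_bundle L)) (Tot (dual_bundle L)) u \<longleftrightarrow>
    (\<forall>c\<in>A. \<forall>i\<in>Idx L. psh_on {w. base_part w \<in> snd c ` (fst c \<inter> Dom L i)} (homogeneous_extension d (h i \<circ> chart_inv c)))"
  unfolding mfd_psh_on_dual_iff by (intro ball_cong refl psh_on_dual_chart_iff[OF X L uh])

section \<open>The correspondence between metrics and homogeneous functions\<close>

lemma metrics_change:
  assumes "h \<in> metrics L" "i \<in> Idx L" "x \<in> Dom L i" "j \<in> Idx L" "x \<in> Dom L j"
  shows "h j x = h i x + ereal (ln (cmod (transition L i j x)))"
  using assms unfolding metrics_def by blast

lemma metrics_less_infinity:
  assumes "h \<in> metrics L" "i \<in> Idx L" "x \<in> Dom L i"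
  shows "h i x < \<infinity>"
proof -
  have "h \<in> (\<Pi>\<^sub>E i\<in>Idx L. Dom L i \<rightarrow>\<^sub>E {-\<infinity>..<\<infinity>})"
    using assms(1) unfolding metrics_def by blast
  then have "h i \<in> Dom L i \<rightarrow>\<^sub>E {-\<infinity>..<\<infinity>}" by (rule PiE_mem) (fact assms(2))
  then have "h i x \<in> {-\<infinity>..<\<infinity>}" by (rule PiE_mem) (fact assms(3))
  then show ?thesis by simp
qed

lemma induces_metric_frame:
  assumes L: "holomorphic_line_bundle X A L" and uh: "induces_metric d L u h"
    and i: "i \<in> Idx L" "x \<in> Dom L i"
  shows "u (frame (dual_bundle L) i x) = exp_ereal (ereal d * h i x)"
proof -
  let ?e = "frame (dual_bundle L) i x"
  have "u ?e = ereal (cmod (Coord (dual_bundle L) i ?e) powr d) * exp_ereal (ereal d * h i x)"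
    using uh i dual_frame(1)[OF L i] unfolding induces_metric_def by blast
  then show ?thesis unfolding dual_frame(2)[OF L i] by (simp flip: one_ereal_def)
qed

lemma induces_metric_unique_metric:
  assumes L: "holomorphic_line_bundle X A L" and d: "d > 0"
    and h: "h \<in> metrics L" "induces_metric d L u h" and h': "h' \<in> metrics L" "induces_metric d L u h'"
  shows "h = h'"
proof -
  have PiE: "h \<in> (\<Pi>\<^sub>E i\<in>Idx L. Dom L i \<rightarrow>\<^sub>E {-\<infinity>..<\<infinity>})" "h' \<in> (\<Pi>\<^sub>E i\<in>Idx L. Dom L i \<rightarrow>\<^sub>E {-\<infinity>..<\<infinity>})"
    using h(1) h'(1) by (auto simp: metrics_def)
  show ?thesis
  proof (rule PiE_ext[OF PiE], rule PiE_ext)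
    fix i assume i: "i \<in> Idx L"
    show "h i \<in> Dom L i \<rightarrow>\<^sub>E {-\<infinity>..<\<infinity>}" "h' i \<in> Dom L i \<rightarrow>\<^sub>E {-\<infinity>..<\<infinity>}"
      by (rule PiE_mem[OF PiE(1) i], rule PiE_mem[OF PiE(2) i])
    fix x assume x: "x \<in> Dom L i"
    show "h i x = h' i x"
      using trans[OF sym[OF induces_metric_frame[OF L h(2) i x]] induces_metric_frame[OF L h'(2) i x]]
      by (simp only: exp_ereal_inject ereal_times_left_cancel[OF d])
  qed
qed

lemma induces_metric_unique_function:
  assumes L: "holomorphic_line_bundle X A L"
    and u: "u \<in> extensional (Tot (dual_bundle L))" "induces_metric d L u h"
    and v: "v \<in> extensional (Tot (dual_bundle L))" "induces_metric d L v h"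
  shows "u = v"
proof (rule extensionalityI[OF u(1) v(1)])
  fix \<xi> assume "\<xi> \<in> Tot (dual_bundle L)"
  then obtain i where "i \<in> Idx L" "fst \<xi> \<in> Dom L i" "\<xi> \<in> fibre (dual_bundle L) (fst \<xi>)"
    by (rule dual_Tot_index[OF L])
  then show "u \<xi> = v \<xi>" using u(2) v(2) by (simp add: induces_metric_def)
qed

text \<open>The factor \<open>\<bar>g\<^sub>i\<^sub>j\<bar>\<^sup>d\<close> lost by the fibre coordinate is gained by the exponential of the weight.\<close>

lemma induced_function_well_defined:
  assumes L: "holomorphic_line_bundle X A L" and h: "h \<in> metrics L" and d: "d > 0"
    and i: "i \<in> Idx L" "x \<in> Dom L i" and j: "j \<in> Idx L" "x \<in> Dom L j"
    and \<xi>: "\<xi> \<in> fibre (dual_bundle L) x"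
  shows "ereal (cmod (Coord (dual_bundle L) i \<xi>) powr d) * exp_ereal (ereal d * h i x)
    = ereal (cmod (Coord (dual_bundle L) j \<xi>) powr d) * exp_ereal (ereal d * h j x)"
proof -
  let ?g = "transition L i j x"
  have g: "?g \<noteq> 0" by (rule frame_eq_transition_scale(2)[OF L i j])
  have hj: "h j x = h i x + ereal (ln (cmod ?g))" by (rule metrics_change[OF h i j])
  have "h i x < \<infinity>" by (rule metrics_less_infinity[OF h i])
  moreover have "cmod ?g powr d = exp (d * ln (cmod ?g))" using g by (simp add: powr_def)
  ultimately show ?thesis
    unfolding dual_coord_change[OF L i j \<xi>] hj using d
    by (cases "h i x") (simp_all add: norm_mult powr_mult distrib_left exp_add mult_ac)
qed

lemma exists_homogeneous_psh:
  fixes A :: "('a, 'n::finite) chart set" and L :: "('a, 'e, 'i) line_bundle"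
  assumes X: "complex_manifold X A" "topspace X \<noteq> {}" and L: "holomorphic_line_bundle X A L"
    and h: "h \<in> positive_metrics A L" and d: "d > 0"
  shows "\<exists>u\<in>homogeneous_psh d A (dual_bundle L). induces_metric d L u h"
proof -
  let ?L = "dual_bundle L"
  have hm: "h \<in> metrics L" and psh: "\<And>i. i \<in> Idx L \<Longrightarrow> mfd_psh_on A (Dom L i) (h i)"
    using h by (auto simp: positive_metrics_def)
  \<comment> \<open>the choice of a trivialization at each point is immaterial by \<open>induced_function_well_defined\<close>\<close>
  define idx where "idx x = (SOME i. i \<in> Idx L \<and> x \<in> Dom L i)" for x
  define u where "u = restrict (\<lambda>\<xi>. ereal (cmod (Coord ?L (idx (fst \<xi>)) \<xi>) powr d)
      * exp_ereal (ereal d * h (idx (fst \<xi>)) (fst \<xi>))) (Tot ?L)"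
  have uh: "induces_metric d L u h"
    unfolding induces_metric_def
  proof (intro ballI)
    fix i x \<xi> assume i: "i \<in> Idx L" "x \<in> Dom L i" and \<xi>: "\<xi> \<in> fibre ?L x"
    have fx: "fst \<xi> = x" and T: "\<xi> \<in> Tot ?L" using \<xi> by (auto simp: fibre_def)
    have j: "idx x \<in> Idx L" "x \<in> Dom L (idx x)"
      using someI[of "\<lambda>i. i \<in> Idx L \<and> x \<in> Dom L i", OF conjI[OF i]] by (auto simp: idx_def)
    have "u \<xi> = ereal (cmod (Coord ?L (idx x) \<xi>) powr d) * exp_ereal (ereal d * h (idx x) x)"
      using T by (simp add: u_def fx del: dual_bundle_sel)
    then show "u \<xi> = ereal (cmod (Coord ?L i \<xi>) powr d) * exp_ereal (ereal d * h i x)"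
      using induced_function_well_defined[OF L hm d j i \<xi>] by (simp only:)
  qed
  have "mfd_psh_on (total_atlas A ?L) (Tot ?L) u"
    unfolding homogeneous_psh_iff_charts[OF X(1) L uh]
    by (intro ballI psh_homogeneous_extension[OF _ d]) (use psh in \<open>auto simp: mfd_psh_on_def\<close>)
  moreover have "u \<in> extensional (Tot ?L)" by (simp add: u_def)
  moreover have "\<forall>\<xi>\<in>Tot ?L. u \<xi> \<ge> 0" by (simp add: u_def)
  moreover have "\<exists>\<xi>\<in>Tot ?L. u \<xi> \<noteq> 0"
  proof -
    obtain x where x: "x \<in> topspace X" using X(2) by blast
    obtain i where i: "i \<in> Idx L" "x \<in> Dom L i" by (rule line_bundle_index[OF L x])
    obtain c where c: "c \<in> A" "x \<in> fst c" using X(1) x unfolding complex_manifold_def by blast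
    let ?V = "snd c ` (fst c \<inter> Dom L i)"
    have p: "psh_on ?V (h i \<circ> chart_inv c)" using psh[OF i(1)] c(1) by (simp add: mfd_psh_on_def)
    have "snd c x \<in> ?V" using c i by blast
    then obtain C where C: "C \<in> components ?V" by (metis Union_components UnionE)
    then obtain z where z: "z \<in> C" "(h i \<circ> chart_inv c) z \<noteq> -\<infinity>" using p unfolding psh_on_def by blast
    then obtain y where y: "y \<in> fst c" "y \<in> Dom L i" "z = snd c y"
      using in_components_subset[OF C] by auto
    have hy: "h i y \<noteq> -\<infinity>" using z(2) y chart_inv_eq[OF X(1) c(1) y(1)] by simp
    note fr = dual_frame[OF L i(1) y(2)]
    have "u (frame ?L i y) = exp_ereal (ereal d * h i y)"
      by (rule induces_metric_frame[OF L uh i(1) y(2)])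
    then have "u (frame ?L i y) \<noteq> 0" using hy d by (cases "h i y") auto
    then show ?thesis using fibre_Tot[OF fr(1)] by blast
  qed
  moreover have "abs_homogeneous d ?L u"
    unfolding abs_homogeneous_def
  proof (intro allI ballI)
    fix c \<xi> assume "\<xi> \<in> Tot ?L"
    then obtain i where i: "i \<in> Idx L" "fst \<xi> \<in> Dom L i" "\<xi> \<in> fibre ?L (fst \<xi>)"
      by (rule dual_Tot_index[OF L])
    note sc = dual_scale[OF L i(1,2,3)]
    have 1: "u \<xi> = ereal (cmod (Coord ?L i \<xi>) powr d) * exp_ereal (ereal d * h i (fst \<xi>))"
      using uh i unfolding induces_metric_def by blast
    have "u (Scale ?L c \<xi>) = ereal (cmod (Coord ?L i (Scale ?L c \<xi>)) powr d) * exp_ereal (ereal d * h i (fst \<xi>))"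
      using uh i sc(1) unfolding induces_metric_def by blast
    then show "u (Scale ?L c \<xi>) = ereal (cmod c powr d) * u \<xi>"
      unfolding 1 sc(2) by (simp add: norm_mult powr_mult mult.assoc del: dual_bundle_sel flip: times_ereal.simps(1))
  qed
  ultimately show ?thesis using uh by (auto simp: homogeneous_psh_def)
qed

definition log_ereal :: "ereal \<Rightarrow> ereal" where
  "log_ereal y = (if y = 0 then -\<infinity> else ereal (ln (real_of_ereal y)))"

lemma exp_log_ereal:
  assumes "0 \<le> y" "y < \<infinity>" "d > 0"
  shows "exp_ereal (ereal d * (log_ereal y / ereal d)) = y"
  using assms by (cases y) (auto simp: log_ereal_def)

text \<open>The interior of \<open>N\<close> is closed: near a point of its closure, the sets involved are carried to a
  coordinate domain by a chart, where the hypothesis \<open>propagate\<close> applies.\<close>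

lemma minus_infinity_everywhere:
  fixes A :: "('a, 'n::finite) chart set" and L :: "('a, 'e, 'i) line_bundle"
  assumes X: "complex_manifold X A" "connected_space X" and L: "holomorphic_line_bundle X A L"
    and N: "\<And>i x. i \<in> Idx L \<Longrightarrow> x \<in> Dom L i \<Longrightarrow> h i x = -\<infinity> \<longleftrightarrow> x \<in> N"
    and propagate: "\<And>c i z. c \<in> A \<Longrightarrow> i \<in> Idx L \<Longrightarrow> z \<in> snd c ` (fst c \<inter> Dom L i) \<Longrightarrow>
      z \<in> closure (interior {z \<in> snd c ` (fst c \<inter> Dom L i). (h i \<circ> chart_inv c) z = -\<infinity>}) \<Longrightarrow>
      z \<in> interior {z \<in> snd c ` (fst c \<inter> Dom L i). (h i \<circ> chart_inv c) z = -\<infinity>}"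
    and U: "openin X U" "U \<noteq> {}" "U \<subseteq> N"
  shows "topspace X \<subseteq> N"
proof -
  let ?V = "\<lambda>c i. snd c ` (fst c \<inter> Dom L i)"
  let ?P = "\<lambda>c i. {z \<in> ?V c i. (h i \<circ> chart_inv c) z = -\<infinity>}"
  have P: "snd c x \<in> ?P c i \<longleftrightarrow> x \<in> N" if "c \<in> A" "i \<in> Idx L" "x \<in> fst c" "x \<in> Dom L i" for c i x
    using that N[OF that(2,4)] chart_inv_eq[OF X(1) that(1,3)] by auto
  let ?W = "X interior_of N"
  have "X closure_of ?W \<subseteq> ?W"
  proof
    fix x assume x: "x \<in> X closure_of ?W"
    then have xX: "x \<in> topspace X" by (simp add: in_closure_of)
    obtain i where i: "i \<in> Idx L" "x \<in> Dom L i" by (rule line_bundle_index[OF L xX])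
    obtain c where c: "c \<in> A" "x \<in> fst c" using X(1) xX unfolding complex_manifold_def by blast
    have D: "openin X (Dom L i)" "openin X (fst c)"
      using L i X(1) c unfolding holomorphic_line_bundle_def complex_manifold_def by blast+
    have "snd c x \<in> closure (interior (?P c i))"
      unfolding closure_iff_nhds_not_empty
    proof (intro allI impI)
      fix B S assume S: "S \<subseteq> B" "open S" "snd c x \<in> S"
      have op: "openin X ({y \<in> fst c. snd c y \<in> S} \<inter> Dom L i)"
        by (intro openin_Int openin_chart_vimage[OF X(1) c(1) S(2)] D)
      have xT: "x \<in> {y \<in> fst c. snd c y \<in> S} \<inter> Dom L i" using S(3) c i by simp
      have "\<exists>y. y \<in> ?W \<and> y \<in> {y \<in> fst c. snd c y \<in> S} \<inter> Dom L i"
        by (rule in_closure_of[THEN iffD1, OF x, THEN conjunct2, THEN spec, THEN mp, OF conjI[OF xT op]])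
      then obtain y where y: "y \<in> ?W" "y \<in> fst c" "snd c y \<in> S" "y \<in> Dom L i"
        by auto
      have "open (snd c ` (fst c \<inter> (?W \<inter> Dom L i)))"
        by (intro open_chart_image[OF X(1) c(1)] openin_Int openin_interior_of D)
      moreover have "snd c ` (fst c \<inter> (?W \<inter> Dom L i)) \<subseteq> ?P c i"
        using P[OF c(1) i(1)] interior_of_subset[of X N] by blast
      ultimately have "snd c y \<in> interior (?P c i)" using y by (intro interiorI[of "snd c ` (fst c \<inter> (?W \<inter> Dom L i))"]) auto
      then show "interior (?P c i) \<inter> B \<noteq> {}" using y S(1) by blast
    qed
    then have "snd c x \<in> interior (?P c i)" using propagate[OF c(1) i(1)] c i by blast
    moreover have "openin X ({y \<in> fst c. snd c y \<in> interior (?P c i)} \<inter> Dom L i)"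
      by (intro openin_Int openin_chart_vimage[OF X(1) c(1)] D) simp
    moreover have "{y \<in> fst c. snd c y \<in> interior (?P c i)} \<inter> Dom L i \<subseteq> N"
      using P[OF c(1) i(1)] interior_subset by blast
    ultimately show "x \<in> ?W" using c i by (auto simp: interior_of_def)
  qed
  then have "closedin X ?W"
    by (metis closure_of_eq closure_of_subset interior_of_subset_topspace subset_antisym)
  then have "?W = {} \<or> ?W = topspace X"
    using X(2) openin_interior_of[of X N] unfolding connected_space_clopen_in by blast
  moreover have "U \<subseteq> ?W" using U by (simp add: interior_of_maximal)
  ultimately have "?W = topspace X" using U(2) by blast
  then show ?thesis using interior_of_subset[of X N] by blast
qed

text \<open>The weights are forced to be \<open>h\<^sub>i = (1/d) log u(e\<^sub>i\<^sup>*)\<close>. Their upper semicontinuity and mean value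
  inequality are local statements. That they are not identically \<open>-\<infinity>\<close> on any component is a
  global one: \<open>u\<close> is known to be nonzero only somewhere, and connectedness of \<open>X\<close> carries this to
  every coordinate domain.\<close>

lemma exists_positive_metric:
  fixes A :: "('a, 'n::finite) chart set" and L :: "('a, 'e, 'i) line_bundle"
  assumes X: "complex_manifold X A" "connected_space X" and L: "holomorphic_line_bundle X A L"
    and u: "u \<in> homogeneous_psh d A (dual_bundle L)" and d: "d > 0"
  shows "\<exists>h\<in>positive_metrics A L. induces_metric d L u h"
proof -
  let ?L = "dual_bundle L"
  have uext: "u \<in> extensional (Tot ?L)" and upsh: "mfd_psh_on (total_atlas A ?L) (Tot ?L) u"
    and u0: "\<And>\<xi>. \<xi> \<in> Tot ?L \<Longrightarrow> u \<xi> \<ge> 0" and une: "\<exists>\<xi>\<in>Tot ?L. u \<xi> \<noteq> 0"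
    and uhom: "\<And>c \<xi>. \<xi> \<in> Tot ?L \<Longrightarrow> u (Scale ?L c \<xi>) = ereal (cmod c powr d) * u \<xi>"
    using u by (auto simp: homogeneous_psh_def abs_homogeneous_def)
  have ufin: "u \<xi> < \<infinity>" if \<xi>: "\<xi> \<in> Tot ?L" for \<xi>
  proof (rule ccontr)
    assume "\<not> ?thesis"
    then have inf: "u \<xi> = \<infinity>" by simp
    obtain i where i: "i \<in> Idx L" "fst \<xi> \<in> Dom L i" by (rule dual_Tot_index[OF L \<xi>])
    then have "fst \<xi> \<in> topspace X" by (rule line_bundle_fibre(1)[OF L])
    then obtain c where c: "c \<in> A" "fst \<xi> \<in> fst c" using X(1) unfolding complex_manifold_def by blast
    let ?C = "dual_chart L c i"
    have mem: "\<xi> \<in> fst ?C" using \<xi> c(2) i(2) by (simp add: dual_chart_def)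
    have "psh_on (snd ?C ` (fst ?C \<inter> Tot ?L)) (u \<circ> chart_inv ?C)"
      using upsh c(1) i(1) unfolding mfd_psh_on_dual_iff by blast
    moreover have "snd ?C \<xi> \<in> snd ?C ` (fst ?C \<inter> Tot ?L)" using mem \<xi> by blast
    ultimately have "(u \<circ> chart_inv ?C) (snd ?C \<xi>) < \<infinity>" unfolding psh_on_def by blast
    then have "u \<xi> < \<infinity>" using dual_chart_inv_eq[OF X(1) L c(1) i(1) mem] by simp
    then show False using inf by simp
  qed
  define h where "h = (\<lambda>i\<in>Idx L. \<lambda>x\<in>Dom L i. log_ereal (u (frame ?L i x)) / ereal d)"
  have exph: "exp_ereal (ereal d * h i x) = u (frame ?L i x)" if "i \<in> Idx L" "x \<in> Dom L i" for i x
    using that exp_log_ereal[OF u0 ufin d] fibre_Tot[OF dual_frame(1)[OF L that]] by (simp add: h_def)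
  have uh: "induces_metric d L u h"
    unfolding induces_metric_def
  proof (intro ballI)
    fix i x \<xi> assume i: "i \<in> Idx L" "x \<in> Dom L i" and \<xi>: "\<xi> \<in> fibre ?L x"
    have "u \<xi> = u (Scale ?L (Coord ?L i \<xi>) (frame ?L i x))" using dual_frame(3)[OF L i \<xi>] by (rule arg_cong)
    also have "\<dots> = ereal (cmod (Coord ?L i \<xi>) powr d) * u (frame ?L i x)"
      by (rule uhom[OF fibre_Tot[OF dual_frame(1)[OF L i]]])
    finally show "u \<xi> = ereal (cmod (Coord ?L i \<xi>) powr d) * exp_ereal (ereal d * h i x)"
      using exph[OF i] by (simp only:)
  qed
  have hfin: "h i x < \<infinity>" if i: "i \<in> Idx L" "x \<in> Dom L i" for i x
    using i d by (auto simp: h_def log_ereal_def)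
  have hm: "h \<in> metrics L"
    unfolding metrics_def
  proof (intro CollectI conjI ballI)
    show "h \<in> (\<Pi>\<^sub>E i\<in>Idx L. Dom L i \<rightarrow>\<^sub>E {- \<infinity>..<\<infinity>})"
    proof (rule PiE_I)
      fix i assume i: "i \<in> Idx L"
      show "h i \<in> Dom L i \<rightarrow>\<^sub>E {- \<infinity>..<\<infinity>}"
        using hfin[OF i] i by (intro PiE_I) (auto simp: h_def)
    qed (simp add: h_def)
    fix i j x assume i: "i \<in> Idx L" and j: "j \<in> Idx L" and "x \<in> Dom L i \<inter> Dom L j"
    then have x: "x \<in> Dom L i" "x \<in> Dom L j" by auto
    let ?g = "transition L i j x"
    have g: "?g \<noteq> 0" by (rule frame_eq_transition_scale(2)[OF L i x(1) j x(2)])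
    note fr = dual_frame[OF L j x(2)]
    have co: "Coord ?L i (frame ?L j x) = ?g"
      using dual_coord_change[OF L i x(1) j x(2) fr(1)] fr(2) by simp
    have "exp_ereal (ereal d * h j x) = u (frame ?L j x)" by (rule exph[OF j x(2)])
    also have "\<dots> = ereal (cmod ?g powr d) * exp_ereal (ereal d * h i x)"
      using uh i x(1) fr(1) co unfolding induces_metric_def by metis
    also have "\<dots> = exp_ereal (ereal d * (h i x + ereal (ln (cmod ?g))))"
      using hfin[OF i x(1)] g d by (cases "h i x") (auto simp: powr_def distrib_left exp_add)
    finally show "h j x = h i x + ereal (ln (cmod ?g))" using ereal_times_left_cancel[OF d] by simp
  qed
  let ?V = "\<lambda>c i. snd c ` (fst c \<inter> Dom L i)"
  have psh': "psh_on {w. base_part w \<in> ?V c i} (homogeneous_extension d (h i \<circ> chart_inv c))"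
    if "c \<in> A" "i \<in> Idx L" for c i
    using upsh that unfolding homogeneous_psh_iff_charts[OF X(1) L uh] by blast
  have fin: "(h i \<circ> chart_inv c) z < \<infinity>" if "c \<in> A" "i \<in> Idx L" "z \<in> ?V c i" for c i z
    using that hfin chart_inv_eq[OF X(1) that(1)] by auto
  have openV: "open (?V c i)" if "c \<in> A" "i \<in> Idx L" for c i
    using open_chart_image[OF X(1) that(1), of "Dom L i"] L that(2) unfolding holomorphic_line_bundle_def by blast
  have usc: "openin (top_of_set (?V c i)) {z\<in>?V c i. (h i \<circ> chart_inv c) z < e}"
    and sub: "(\<forall>\<zeta>\<in>cball 0 1. a + \<zeta> *s w \<in> ?V c i) \<Longrightarrow>
      (h i \<circ> chart_inv c) a \<le> circle_mean (h i \<circ> chart_inv c) a w"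
    if "c \<in> A" "i \<in> Idx L" for c i e a w
    using log_psh_of_homogeneous_extension[OF psh'[OF that] d fin[OF that]] by blast+
  define N where "N = {x \<in> topspace X. \<exists>i\<in>Idx L. x \<in> Dom L i \<and> h i x = -\<infinity>}"
  have N: "h i x = -\<infinity> \<longleftrightarrow> x \<in> N" if i: "i \<in> Idx L" "x \<in> Dom L i" for i x
  proof
    show "x \<in> N" if "h i x = -\<infinity>"
      using that i line_bundle_fibre(1)[OF L i] by (auto simp: N_def)
    assume "x \<in> N"
    then obtain j where j: "j \<in> Idx L" "x \<in> Dom L j" "h j x = -\<infinity>" by (auto simp: N_def)
    have "h i x = h j x + ereal (ln (cmod (transition L j i x)))"
      by (rule metrics_change[OF hm j(1,2) i])
    then show "h i x = -\<infinity>" using j(3) by simp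
  qed
  have notN: "\<not> U \<subseteq> N" if U: "openin X U" "U \<noteq> {}" for U
  proof
    assume "U \<subseteq> N"
    have all: "topspace X \<subseteq> N"
      by (rule minus_infinity_everywhere[OF X L N _ U \<open>U \<subseteq> N\<close>], assumption, assumption)
        (rule minus_infinity_propagates[OF openV usc fin sub])
    obtain \<xi> where \<xi>: "\<xi> \<in> Tot ?L" "u \<xi> \<noteq> 0" using une by blast
    obtain i where i: "i \<in> Idx L" "fst \<xi> \<in> Dom L i" "\<xi> \<in> fibre ?L (fst \<xi>)" by (rule dual_Tot_index[OF L \<xi>(1)])
    have "fst \<xi> \<in> N" using all line_bundle_fibre(1)[OF L i(1,2)] by blast
    then have "h i (fst \<xi>) = -\<infinity>" using N[OF i(1,2)] by simp
    moreover have "u \<xi> = ereal (cmod (Coord ?L i \<xi>) powr d) * exp_ereal (ereal d * h i (fst \<xi>))"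
      using uh i unfolding induces_metric_def by blast
    ultimately show False using \<xi>(2) d by simp
  qed
  have "mfd_psh_on A (Dom L i) (h i)" if i: "i \<in> Idx L" for i
    unfolding mfd_psh_on_def psh_on_def
  proof (intro ballI conjI allI impI)
    fix c assume c: "c \<in> A"
    show "(h i \<circ> chart_inv c) z < \<infinity>" if "z \<in> ?V c i" for z by (rule fin[OF c i that])
    show "openin (top_of_set (?V c i)) {z\<in>?V c i. (h i \<circ> chart_inv c) z < e}" for e by (rule usc[OF c i])
    show "(h i \<circ> chart_inv c) a \<le> circle_mean (h i \<circ> chart_inv c) a w" if "\<forall>\<zeta>\<in>cball 0 1. a + \<zeta> *s w \<in> ?V c i" for a w
      by (rule sub[OF c i that])
    fix C assume C: "C \<in> components (?V c i)"
    have "open C" by (rule open_components[OF openV[OF c i] C])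
    then have "openin X {x \<in> fst c. snd c x \<in> C}" by (rule openin_chart_vimage[OF X(1) c])
    then have op: "openin X ({x \<in> fst c. snd c x \<in> C} \<inter> Dom L i)"
      using L i unfolding holomorphic_line_bundle_def by (intro openin_Int) blast+
    obtain z where z: "z \<in> C" using in_components_nonempty[OF C] by blast
    then have "{x \<in> fst c. snd c x \<in> C} \<inter> Dom L i \<noteq> {}"
      using in_components_subset[OF C] by blast
    from notN[OF op this] obtain x where x: "x \<in> fst c" "snd c x \<in> C" "x \<in> Dom L i" "x \<notin> N" by blast
    then have "h i x \<noteq> -\<infinity>" using N[OF i x(3)] by simp
    then show "\<exists>z\<in>C. (h i \<circ> chart_inv c) z \<noteq> -\<infinity>"
      using x chart_inv_eq[OF X(1) c x(1)] by (intro bexI[of _ "snd c x"]) auto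
  qed
  then show ?thesis using hm uh by (auto simp: positive_metrics_def)
qed

theorem theorem1:
  fixes X :: "'a topology" and A :: "('a, 'n::finite) chart set"
    and L :: "('a, 'e, 'i) line_bundle" and d :: real
  assumes "kaehler_manifold X A"
    and "compact_space X"
    and "connected_space X" and "topspace X \<noteq> {}"
    and "holomorphic_line_bundle X A L"
    and "positive_line_bundle A L"
    and "d > 0"
  shows "\<exists>\<Phi>. bij_betw \<Phi> (homogeneous_psh d A (dual_bundle L)) (positive_metrics A L) \<and>
           (\<forall>u\<in>homogeneous_psh d A (dual_bundle L). induces_metric d L u (\<Phi> u))"
proof -
  let ?H = "homogeneous_psh d A (dual_bundle L)" and ?P = "positive_metrics A L"
  have X: "complex_manifold X A" using assms(1) by (simp add: kaehler_manifold_def)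
  have metric: "\<forall>u\<in>?H. \<exists>h\<in>?P. induces_metric d L u h"
    using exists_positive_metric[OF X assms(3,5) _ assms(7)] by blast
  then obtain \<Phi> where \<Phi>: "\<And>u. u \<in> ?H \<Longrightarrow> \<Phi> u \<in> ?P" "\<And>u. u \<in> ?H \<Longrightarrow> induces_metric d L u (\<Phi> u)"
    by metis
  have "inj_on \<Phi> ?H"
  proof (rule inj_onI)
    fix u v assume u: "u \<in> ?H" and v: "v \<in> ?H" and eq: "\<Phi> u = \<Phi> v"
    show "u = v"
      by (rule induces_metric_unique_function[OF assms(5) _ \<Phi>(2)[OF u]])
        (use u v \<Phi>(2)[OF v] eq in \<open>auto simp: homogeneous_psh_def\<close>)
  qed
  moreover have "h \<in> \<Phi> ` ?H" if h: "h \<in> ?P" for h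
  proof -
    obtain u where u: "u \<in> ?H" "induces_metric d L u h"
      using exists_homogeneous_psh[OF X assms(4,5) h assms(7)] by blast
    have "h = \<Phi> u"
      by (rule induces_metric_unique_metric[OF assms(5,7) _ u(2) _ \<Phi>(2)[OF u(1)]])
        (use h \<Phi>(1)[OF u(1)] in \<open>auto simp: positive_metrics_def\<close>)
    then show ?thesis using u(1) by blast
  qed
  ultimately have "bij_betw \<Phi> ?H ?P" using \<Phi>(1) by (auto simp: bij_betw_def)
  then show ?thesis using \<Phi>(2) by blast
qed

end
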